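(* Let $p$ and $q$ be primes such that $q \mid (p-1)$ and $q^2 < q + p + 1$. Let $F_{p,q} = \langle a,b : a^p = b^q = 1,\ b^{-1}ab = a^u\rangle$, where $u$ is an integer whose class $\bar{u}\in\mathbb{Z}_p^*$ has order $q$. Then $E(\Gamma_{nc}(F_{p,q})) \leq LE(\Gamma_{nc}(F_{p,q}))$.
   Context: For a finite non-abelian group $G$ with center $Z(G)$, the non-commuting graph $\Gamma_{nc}(G)$ is the simple undirected graph with vertex set $G\setminus Z(G)$, in which two vertices $x,y$ are adjacent if and only if $xy \ne yx$. For a finite simple graph $\mathcal{G}$ with vertex set $v(\mathcal{G})$ and edge set $e(\mathcal{G})$, the energy $E(\mathcal{G})$ is the sum of $|\lambda|$ over the eigenvalues $\lambda$ of the adjacency matrix $\mathcal{A}(\mathcal{G})$, and the Laplacian energy is $LE(\mathcal{G}) = \sum_{\mu}\left|\mu - \frac{2|e(\mathcal{G})|}{|v(\mathcal{G})|}\right|$, the sum over the eigenvalues $\mu$ of the Laplacian matrix $L(\mathcal{G}) = D(\mathcal{G}) - \mathcal{A}(\mathcal{G})$, where $D(\mathcal{G})$ is the diagonal degree matrix; eigenvalues are counted with multiplicity. *)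

theory Defs
  imports
    "HOL-Number_Theory.Number_Theory"
    "HOL-Library.Countable_Set"
    "HOL-Computational_Algebra.Polynomial"
    "Jordan_Normal_Form.Char_Poly"
    Complex_Main
begin

section \<open>Groups given by generators and relations\<close>

text \<open>
  A word is a list of letters \<open>(g, True)\<close>, standing for the generator \<open>g\<close>, and \<open>(g, False)\<close>,
  standing for its formal inverse. A relation is a pair \<open>(l, r)\<close> of words, read as \<open>l = r\<close>.
  Two words are identified iff they represent the same element of the free group on \<open>'g\<close>
  modulo the normal closure of all \<open>l\<close> times the inverse of \<open>r\<close>.
\<close>

type_synonym 'g word = "('g \<times> bool) list"

inductive pres_eq :: "('g word \<times> 'g word) set \<Rightarrow> 'g word \<Rightarrow> 'g word \<Rightarrow> bool"
  for R :: "('g word \<times> 'g word) set" where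
  refl: "pres_eq R w w"
| sym: "pres_eq R v w \<Longrightarrow> pres_eq R w v"
| trans: "pres_eq R v w \<Longrightarrow> pres_eq R w x \<Longrightarrow> pres_eq R v x"
| cancel: "pres_eq R (xs @ [(g, s), (g, \<not> s)] @ ys) (xs @ ys)"
| relation: "(l, r) \<in> R \<Longrightarrow> pres_eq R (xs @ l @ ys) (xs @ r @ ys)"

definition pres_class :: "('g word \<times> 'g word) set \<Rightarrow> 'g word \<Rightarrow> 'g word set" where
  "pres_class R w = {v. pres_eq R w v}"

definition presented_group :: "('g word \<times> 'g word) set \<Rightarrow> 'g word set monoid" where
  "presented_group R =
    \<lparr> carrier = range (pres_class R),
      monoid.mult = (\<lambda>A B. \<Union>x\<in>A. \<Union>y\<in>B. pres_class R (x @ y)),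
      one = pres_class R [] \<rparr>"

text \<open>The \<open>k\<close>-th power of the generator \<open>g\<close>, for an integer \<open>k\<close>.\<close>

definition gen_pow :: "'g \<Rightarrow> int \<Rightarrow> 'g word" where
  "gen_pow g k = replicate (nat \<bar>k\<bar>) (g, 0 \<le> k)"

lemma pres_class_eq_iff: "pres_class R v = pres_class R w \<longleftrightarrow> pres_eq R v w"
  unfolding pres_class_def by (blast intro: pres_eq.intros)

lemma pres_eq_context: "pres_eq R v w \<Longrightarrow> pres_eq R (xs @ v @ ys) (xs @ w @ ys)"
proof (induction rule: pres_eq.induct)
  case (cancel us g s vs)
  show ?case using pres_eq.cancel[of R "xs @ us" g s "vs @ ys"] by simp
next
  case (relation l r us vs)
  show ?case using pres_eq.relation[OF relation, of "xs @ us" "vs @ ys"] by simp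
qed (blast intro: pres_eq.intros)+

lemma pres_eq_append: "pres_eq R v v' \<Longrightarrow> pres_eq R w w' \<Longrightarrow> pres_eq R (v @ w) (v' @ w')"
  using pres_eq_context[of R v v' "[]" w] pres_eq_context[of R w w' v' "[]"]
  by (auto intro: pres_eq.trans)

lemma presented_group_mult:
  "pres_class R v \<otimes>\<^bsub>presented_group R\<^esub> pres_class R w = pres_class R (v @ w)"
proof -
  have "pres_class R (x @ y) = pres_class R (v @ w)"
    if "x \<in> pres_class R v" "y \<in> pres_class R w" for x y
  proof -
    have "pres_eq R v x" "pres_eq R w y" using that by (simp_all add: pres_class_def)
    then have "pres_eq R (v @ w) (x @ y)" by (rule pres_eq_append)
    then show ?thesis unfolding pres_class_eq_iff by (rule pres_eq.sym)
  qed
  then have "(\<Union>x\<in>pres_class R v. \<Union>y\<in>pres_class R w. pres_class R (x @ y)) =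
      (\<Union>x\<in>pres_class R v. \<Union>y\<in>pres_class R w. pres_class R (v @ w))"
    by (intro SUP_cong HOL.refl)
  moreover have "v \<in> pres_class R v" "w \<in> pres_class R w"
    by (simp_all add: pres_class_def pres_eq.refl)
  then have "pres_class R v \<noteq> {}" "pres_class R w \<noteq> {}" by blast+
  ultimately show ?thesis by (simp add: presented_group_def)
qed

lemma pres_eq_inverse: "pres_eq R (rev (map (\<lambda>(g, s). (g, \<not> s)) w) @ w) []"
proof (induction w)
  case (Cons a w)
  obtain g s where a: "a = (g, s)" by (cases a)
  let ?i = "rev (map (\<lambda>(g, s). (g, \<not> s)) w)"
  have "pres_eq R (?i @ [(g, \<not> s), (g, \<not> \<not> s)] @ w) (?i @ w)" by (rule pres_eq.cancel)
  with Cons show ?case by (auto simp: a intro: pres_eq.trans)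
qed (simp add: pres_eq.refl)

lemma group_presented_group: "group (presented_group R)"
proof (rule groupI)
  let ?G = "presented_group R"
  have car: "carrier ?G = range (pres_class R)" and one: "\<one>\<^bsub>?G\<^esub> = pres_class R []"
    by (simp_all add: presented_group_def)
  show "\<one>\<^bsub>?G\<^esub> \<in> carrier ?G" by (simp add: car one)
  fix x y z assume x: "x \<in> carrier ?G" 
  then obtain u where u: "x = pres_class R u" by (auto simp: car)
  show "\<one>\<^bsub>?G\<^esub> \<otimes>\<^bsub>?G\<^esub> x = x" by (simp add: u one presented_group_mult)
  show "\<exists>y\<in>carrier ?G. y \<otimes>\<^bsub>?G\<^esub> x = \<one>\<^bsub>?G\<^esub>"
    by (auto simp: u one car presented_group_mult pres_class_eq_iff intro: pres_eq_inverse)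
  assume "y \<in> carrier ?G"
  then obtain v where v: "y = pres_class R v" by (auto simp: car)
  show "x \<otimes>\<^bsub>?G\<^esub> y \<in> carrier ?G" by (simp add: u v car presented_group_mult)
  assume "z \<in> carrier ?G"
  then obtain w where w: "z = pres_class R w" by (auto simp: car)
  show "x \<otimes>\<^bsub>?G\<^esub> y \<otimes>\<^bsub>?G\<^esub> z = x \<otimes>\<^bsub>?G\<^esub> (y \<otimes>\<^bsub>?G\<^esub> z)"
    by (simp add: u v w presented_group_mult)
qed


section \<open>The groups \<open>F\<^bsub>p,q\<^esub>\<close>\<close>

datatype gen = Gen_a | Gen_b

definition F_relations :: "nat \<Rightarrow> nat \<Rightarrow> int \<Rightarrow> (gen word \<times> gen word) set" where
  "F_relations p q u =
    { (gen_pow Gen_a (int p), []),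
      (gen_pow Gen_b (int q), []),
      (gen_pow Gen_b (-1) @ gen_pow Gen_a 1 @ gen_pow Gen_b 1, gen_pow Gen_a u) }"

definition F_group :: "nat \<Rightarrow> nat \<Rightarrow> int \<Rightarrow> gen word set monoid" where
  "F_group p q u = presented_group (F_relations p q u)"


section \<open>Finite simple graphs, energy and Laplacian energy\<close>

text \<open>Edges are unordered pairs of distinct vertices, so their cardinality is the number of
  undirected edges.\<close>

record 'a ugraph =
  vertices :: "'a set"
  edges :: "'a set set"

definition finite_simple_graph :: "'a ugraph \<Rightarrow> bool" where
  "finite_simple_graph \<G> \<longleftrightarrow> finite (vertices \<G>) \<and>
     (\<forall>e\<in>edges \<G>. \<exists>x\<in>vertices \<G>. \<exists>y\<in>vertices \<G>. x \<noteq> y \<and> e = {x, y})"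

definition vertex_degree :: "'a ugraph \<Rightarrow> 'a \<Rightarrow> nat" where
  "vertex_degree \<G> x = card {e \<in> edges \<G>. x \<in> e}"

text \<open>Rows and columns are indexed through the enumeration \<open>from_nat_into\<close> of the finite vertex
  set; a different enumeration conjugates all three matrices by a permutation matrix.\<close>

definition adjacency_matrix :: "'a ugraph \<Rightarrow> real mat" where
  "adjacency_matrix \<G> = mat (card (vertices \<G>)) (card (vertices \<G>))
     (\<lambda>(i, j). if {from_nat_into (vertices \<G>) i, from_nat_into (vertices \<G>) j} \<in> edges \<G>
               then 1 else 0)"

definition degree_matrix :: "'a ugraph \<Rightarrow> real mat" where
  "degree_matrix \<G> = mat (card (vertices \<G>)) (card (vertices \<G>))
     (\<lambda>(i, j). if i = j then real (vertex_degree \<G> (from_nat_into (vertices \<G>) i)) else 0)"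

definition laplacian_matrix :: "'a ugraph \<Rightarrow> real mat" where
  "laplacian_matrix \<G> = degree_matrix \<G> - adjacency_matrix \<G>"

text \<open>All complex eigenvalues, with multiplicity. For the symmetric matrices above they are real
  and algebraic and geometric multiplicities agree.\<close>

definition eigenvalue_mset :: "real mat \<Rightarrow> complex multiset" where
  "eigenvalue_mset M = proots (char_poly (map_mat complex_of_real M))"

definition energy :: "'a ugraph \<Rightarrow> real" where
  "energy \<G> = (\<Sum>z\<in>#eigenvalue_mset (adjacency_matrix \<G>). cmod z)"

definition laplacian_energy :: "'a ugraph \<Rightarrow> real" where
  "laplacian_energy \<G> = (\<Sum>\<mu>\<in>#eigenvalue_mset (laplacian_matrix \<G>).
     cmod (\<mu> - complex_of_real (2 * real (card (edges \<G>)) / real (card (vertices \<G>)))))"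


section \<open>The non-commuting graph\<close>

definition group_center :: "('a, 'b) monoid_scheme \<Rightarrow> 'a set" where
  "group_center G = {z \<in> carrier G. \<forall>x\<in>carrier G. z \<otimes>\<^bsub>G\<^esub> x = x \<otimes>\<^bsub>G\<^esub> z}"

definition noncommuting_graph :: "('a, 'b) monoid_scheme \<Rightarrow> 'a ugraph" where
  "noncommuting_graph G =
    \<lparr> vertices = carrier G - group_center G,
      edges = {{x, y} | x y. x \<in> carrier G - group_center G \<and> y \<in> carrier G - group_center G \<and>
                             x \<otimes>\<^bsub>G\<^esub> y \<noteq> y \<otimes>\<^bsub>G\<^esub> x} \<rparr>"

lemma finite_simple_graph_noncommuting_graph:
  "finite (carrier G) \<Longrightarrow> finite_simple_graph (noncommuting_graph G)"
proof -
  assume "finite (carrier G)"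
  moreover have "\<exists>x\<in>vertices (noncommuting_graph G). \<exists>y\<in>vertices (noncommuting_graph G).
      x \<noteq> y \<and> e = {x, y}" if "e \<in> edges (noncommuting_graph G)" for e
  proof -
    from that obtain x y where "e = {x, y}" "x \<in> carrier G - group_center G"
      "y \<in> carrier G - group_center G" "x \<otimes>\<^bsub>G\<^esub> y \<noteq> y \<otimes>\<^bsub>G\<^esub> x"
      unfolding noncommuting_graph_def ugraph.simps by blast
    moreover from this(4) have "x \<noteq> y" by metis
    ultimately show ?thesis unfolding noncommuting_graph_def ugraph.simps by blast
  qed
  ultimately show ?thesis by (simp add: finite_simple_graph_def noncommuting_graph_def)
qed

end

theory Submission
  imports Defs "Jordan_Normal_Form.Schur_Decomposition"
begin

text \<open>
  The words in \<open>a\<close> and \<open>b\<close> act on the residues modulo \<open>p\<close> by \<open>a: x \<mapsto> x + 1\<close> and \<open>b: x \<mapsto> u x\<close>, and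
  two words are equal in \<open>F\<^bsub>p,q\<^esub>\<close> iff they act alike (\<open>equiv_word_iff_same_map\<close>). So \<open>F\<^bsub>p,q\<^esub>\<close> is a
  group of affine maps of order \<open>p q\<close>. A map other than the identity is either a translation or has
  exactly one fixed point, and two such maps commute iff both are translations or both have the same
  fixed point. The centre is therefore trivial, and the non-commuting graph is the complete
  multipartite graph with one part of size \<open>p - 1\<close> (translations) and \<open>p\<close> parts of size \<open>q - 1\<close> (one
  for each fixed point); this is \<open>noncommuting_graph_multipartite\<close>.

  Put \<open>n = p q - 1\<close> for the number of vertices, \<open>d\<close> for the average degree and
  \<open>K = (p - 1) (q - 1)\<close>. The two energies are estimated without computing multiplicities of
  eigenvalues.

  \<^item> The positive eigenvalues of the adjacency matrix all equal the positive root \<open>l\<close> of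
    \<open>l\<^sup>2 = K l + p K\<close>. The squares of all eigenvalues add up to twice the number of edges, which is
    less than \<open>2 l\<^sup>2\<close>, so there is at most one positive eigenvalue. As the trace is zero, the energy
    is twice the sum of the positive eigenvalues, hence at most \<open>2 l\<close>.

  \<^item> The Laplacian eigenvalues \<open>\<mu>\<close> lie in the interval from \<open>0\<close> to \<open>n\<close>, so \<open>2 \<mu> / n - 1\<close> has absolute
    value at most \<open>1\<close> and \<open>\<bar>\<mu> - d\<bar> \<ge> (\<mu> - d) (2 \<mu> / n - 1)\<close>. The sum of the right-hand sides depends only on
    the traces of the Laplacian matrix and of its square, that is, on the degrees. It equals \<open>2 X\<close>
    with \<open>X = p K ((q + 1) n + (p - q)\<^sup>2) / n\<^sup>2\<close>.

  It remains to see \<open>l \<le> X\<close>, i.e. \<open>X (X - K) \<ge> p K\<close>, which is \<open>positive_root_le\<close>: after clearing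
  denominators, the difference of the two sides has the factor \<open>(p - q)\<^sup>2\<close>, and the cofactor is visibly
  nonnegative.
\<close>

section \<open>Eigenvalues and traces\<close>

lemma proots_linear_factors: "proots (\<Prod>a\<leftarrow>as. [:- a, 1:]) = mset (as :: complex list)"
proof (induction as)
  case (Cons a as)
  have "(\<Prod>a\<leftarrow>as. [:- a, 1:]) \<noteq> 0" by (auto simp: prod_list_zero_iff)
  with Cons show ?case by (simp add: proots_mult del: mult_pCons_left)
qed simp

lemma trace_mult_commute:
  fixes A B :: "'a :: comm_ring_1 mat"
  assumes "A \<in> carrier_mat n m" "B \<in> carrier_mat m n"
  shows "(\<Sum>i<n. (A * B) $$ (i, i)) = (\<Sum>i<m. (B * A) $$ (i, i))"
proof -
  have "(\<Sum>i<n. (A * B) $$ (i, i)) = (\<Sum>i<n. \<Sum>j<m. A $$ (i, j) * B $$ (j, i))"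
    using assms by (intro sum.cong) (auto simp: scalar_prod_def atLeast0LessThan)
  also have "\<dots> = (\<Sum>j<m. \<Sum>i<n. B $$ (j, i) * A $$ (i, j))"
    by (subst sum.swap) (simp add: mult.commute)
  also have "\<dots> = (\<Sum>j<m. (B * A) $$ (j, j))"
    using assms by (intro sum.cong) (auto simp: scalar_prod_def atLeast0LessThan)
  finally show ?thesis .
qed

lemma trace_similar:
  fixes A B :: "'a :: comm_ring_1 mat"
  assumes A: "A \<in> carrier_mat n n" and sim: "similar_mat_wit A B P Q"
  shows "(\<Sum>i<n. A $$ (i, i)) = (\<Sum>i<n. B $$ (i, i))"
proof -
  note w = similar_mat_witD2[OF A sim]
  have "(\<Sum>i<n. A $$ (i, i)) = (\<Sum>i<n. (P * (B * Q)) $$ (i, i))"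
    using w by (simp add: assoc_mult_mat[of P n n B n Q n])
  also have "\<dots> = (\<Sum>i<n. ((B * Q) * P) $$ (i, i))"
    using w by (intro trace_mult_commute) auto
  also have "(B * Q) * P = B"
    using w by (simp add: assoc_mult_mat[of B n n Q n P n])
  finally show ?thesis .
qed

lemma similar_mat_wit_square:
  fixes A B :: "'a :: comm_ring_1 mat"
  assumes A: "A \<in> carrier_mat n n" and sim: "similar_mat_wit A B P Q"
  shows "similar_mat_wit (A * A) (B * B) P Q"
  using similar_mat_wit_pow[OF sim, of 2] similar_mat_witD2[OF A sim] A
  by (simp add: numeral_2_eq_2)

lemma upper_triangular_square_diag:
  fixes B :: "'a :: comm_ring_1 mat"
  assumes B: "B \<in> carrier_mat n n" and ut: "upper_triangular B" and i: "i < n"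
  shows "(B * B) $$ (i, i) = (B $$ (i, i))\<^sup>2"
proof -
  have "(B * B) $$ (i, i) = (\<Sum>j<n. B $$ (i, j) * B $$ (j, i))"
    using B i by (auto simp: scalar_prod_def atLeast0LessThan)
  also have "\<dots> = (\<Sum>j\<in>{i}. B $$ (i, j) * B $$ (j, i))"
  proof (intro sum.mono_neutral_right ballI)
    fix j assume "j \<in> {..<n} - {i}"
    then consider "j < i" | "i < j" "j < n" by fastforce
    then show "B $$ (i, j) * B $$ (j, i) = 0"
      using upper_triangularD[OF ut] B i by cases auto
  qed (use i in auto)
  finally show ?thesis by (simp add: power2_eq_square)
qed

text \<open>A complex matrix is similar to an upper triangular one with its eigenvalues on the diagonal (Schur).
  Similarity preserves the traces of the matrix and of its square, and for a triangular matrix these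
  are the sums of the diagonal entries and of their squares.\<close>

lemma eigenvalue_mset_sums:
  fixes M :: "real mat"
  assumes M: "M \<in> carrier_mat n n"
  shows "size (eigenvalue_mset M) = n"
    and "(\<Sum>z\<in>#eigenvalue_mset M. z) = of_real (\<Sum>i<n. M $$ (i, i))"
    and "(\<Sum>z\<in>#eigenvalue_mset M. z\<^sup>2) = of_real (\<Sum>i<n. \<Sum>j<n. M $$ (i, j) * M $$ (j, i))"
proof -
  define C where "C = map_mat complex_of_real M"
  have C: "C \<in> carrier_mat n n" using M by (simp add: C_def)
  obtain as where as: "char_poly C = (\<Prod>a\<leftarrow>as. [:- a, 1:])" "length as = n"
    using char_poly_factorized[OF C] by blast
  obtain B P Q where sd: "schur_decomposition C as = (B, P, Q)"
    by (metis prod_cases3)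
  have sim: "similar_mat_wit C B P Q" and ut: "upper_triangular B" and dB: "diag_mat B = as"
    using schur_decomposition[OF C as(1) sd] by auto
  have B: "B \<in> carrier_mat n n" using similar_mat_witD2[OF C sim] by auto
  have ev: "eigenvalue_mset M = mset as"
    by (simp add: eigenvalue_mset_def C_def[symmetric] as(1) proots_linear_factors)
  have asB: "as = map (\<lambda>i. B $$ (i, i)) [0..<n]"
    using B by (simp add: dB[symmetric] diag_mat_def)
  have sum_as: "(\<Sum>z\<in>#mset as. f z) = (\<Sum>i<n. f (B $$ (i, i)))" for f :: "complex \<Rightarrow> complex"
    by (simp add: asB sum_unfold_sum_mset atLeast0LessThan image_mset.compositionality o_def)
  show "size (eigenvalue_mset M) = n" by (simp add: ev as)
  show "(\<Sum>z\<in>#eigenvalue_mset M. z) = of_real (\<Sum>i<n. M $$ (i, i))"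
    using trace_similar[OF C sim] M sum_as[of "\<lambda>z. z"] by (simp add: ev C_def)
  have "(\<Sum>z\<in>#eigenvalue_mset M. z\<^sup>2) = (\<Sum>i<n. (B * B) $$ (i, i))"
    unfolding ev sum_as by (intro sum.cong) (auto simp: upper_triangular_square_diag[OF B ut])
  also have "\<dots> = (\<Sum>i<n. (C * C) $$ (i, i))"
    by (rule trace_similar[OF _ similar_mat_wit_square[OF C sim], symmetric]) (use C in auto)
  also have "\<dots> = (\<Sum>i<n. \<Sum>j<n. C $$ (i, j) * C $$ (j, i))"
    using C by (intro sum.cong) (auto simp: scalar_prod_def atLeast0LessThan)
  also have "\<dots> = of_real (\<Sum>i<n. \<Sum>j<n. M $$ (i, j) * M $$ (j, i))"
    using M by (simp add: C_def)
  finally show "(\<Sum>z\<in>#eigenvalue_mset M. z\<^sup>2) = of_real (\<Sum>i<n. \<Sum>j<n. M $$ (i, j) * M $$ (j, i))" .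
qed

lemma eigenvalue_msetE:
  fixes M :: "real mat"
  assumes M: "M \<in> carrier_mat n n" and z: "z \<in># eigenvalue_mset M"
  obtains v i where "i < n" "v i \<noteq> 0"
    and "\<And>i. i < n \<Longrightarrow> (\<Sum>j<n. of_real (M $$ (i, j)) * v j) = z * v i"
proof -
  define C where "C = map_mat complex_of_real M"
  have C: "C \<in> carrier_mat n n" using M by (simp add: C_def)
  have "char_poly C \<noteq> 0" using degree_monic_char_poly[OF C] by auto
  with z have "poly (char_poly C) z = 0" by (simp add: eigenvalue_mset_def C_def)
  then have "eigenvalue C z" using eigenvalue_root_char_poly[OF C] by simp
  then obtain v where v: "v \<in> carrier_vec n" "v \<noteq> 0\<^sub>v n" "C *\<^sub>v v = z \<cdot>\<^sub>v v"
    using C by (auto simp: eigenvalue_def eigenvector_def)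
  obtain i where i: "i < n" "v $ i \<noteq> 0"
    using v(1,2) by (metis eq_vecI carrier_vecD index_zero_vec)
  have "(\<Sum>j<n. of_real (M $$ (k, j)) * v $ j) = z * v $ k" if k: "k < n" for k
  proof -
    have "(C *\<^sub>v v) $ k = (\<Sum>j<n. of_real (M $$ (k, j)) * v $ j)"
      using C M k v(1) by (auto simp: scalar_prod_def atLeast0LessThan C_def intro!: sum.cong)
    with v k show ?thesis by simp
  qed
  with i that show ?thesis by blast
qed

text \<open>The matrices of a graph are indexed by numbers through an enumeration of the vertices. This form
  lets traces and eigenvectors be expressed by sums over vertices, so that the enumeration does not
  occur in later arguments.\<close>

definition vertex_matrix :: "'a set \<Rightarrow> ('a \<Rightarrow> 'a \<Rightarrow> real) \<Rightarrow> real mat" where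
  "vertex_matrix V f = mat (card V) (card V)
     (\<lambda>(i, j). f (from_nat_into V i) (from_nat_into V j))"

lemma sum_from_nat_into:
  "finite V \<Longrightarrow> (\<Sum>i<card V. f (from_nat_into V i)) = (\<Sum>x\<in>V. f x)"
  by (rule sum.reindex_bij_betw) (rule bij_betw_from_nat_into_finite)

lemma vertex_matrix_eigenvalue_sums:
  fixes f :: "'a \<Rightarrow> 'a \<Rightarrow> real"
  assumes V: "finite V"
  shows "size (eigenvalue_mset (vertex_matrix V f)) = card V"
    and "(\<Sum>z\<in>#eigenvalue_mset (vertex_matrix V f). z) = of_real (\<Sum>x\<in>V. f x x)"
    and "(\<Sum>z\<in>#eigenvalue_mset (vertex_matrix V f). z\<^sup>2) = of_real (\<Sum>x\<in>V. \<Sum>y\<in>V. f x y * f y x)"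
proof -
  let ?M = "vertex_matrix V f"
  have M: "?M \<in> carrier_mat (card V) (card V)" by (simp add: vertex_matrix_def)
  note sums = eigenvalue_mset_sums[OF M]
  show "size (eigenvalue_mset ?M) = card V" by (fact sums(1))
  show "(\<Sum>z\<in>#eigenvalue_mset ?M. z) = of_real (\<Sum>x\<in>V. f x x)"
    unfolding sums(2) by (simp add: vertex_matrix_def flip: sum_from_nat_into[OF V])
  show "(\<Sum>z\<in>#eigenvalue_mset ?M. z\<^sup>2) = of_real (\<Sum>x\<in>V. \<Sum>y\<in>V. f x y * f y x)"
    unfolding sums(3) by (simp add: vertex_matrix_def flip: sum_from_nat_into[OF V])
qed

lemma vertex_matrix_eigenvalueE:
  fixes f :: "'a \<Rightarrow> 'a \<Rightarrow> real"
  assumes V: "finite V" and z: "z \<in># eigenvalue_mset (vertex_matrix V f)"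
  obtains w x where "x \<in> V" "w x \<noteq> 0"
    and "\<And>x. x \<in> V \<Longrightarrow> (\<Sum>y\<in>V. of_real (f x y) * w y) = z * w x"
proof -
  let ?M = "vertex_matrix V f" and ?e = "from_nat_into V"
  have M: "?M \<in> carrier_mat (card V) (card V)" by (simp add: vertex_matrix_def)
  obtain v i where i: "i < card V" "v i \<noteq> 0"
    and v: "\<And>i. i < card V \<Longrightarrow> (\<Sum>j<card V. of_real (?M $$ (i, j)) * v j) = z * v i"
    using eigenvalue_msetE[OF M z] by blast
  have bij: "bij_betw ?e {..<card V} V" by (rule bij_betw_from_nat_into_finite[OF V])
  define w where "w = v \<circ> the_inv_into {..<card V} ?e"
  have w: "w (?e j) = v j" if "j < card V" for j
    using that bij by (simp add: w_def the_inv_into_f_f bij_betw_def)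
  show ?thesis
  proof
    show "?e i \<in> V" using i bij by (auto simp: bij_betw_def)
    show "w (?e i) \<noteq> 0" using i w by simp
    fix x assume "x \<in> V"
    then obtain k where k: "k < card V" "x = ?e k" using bij by (auto simp: bij_betw_def)
    have "(\<Sum>y\<in>V. of_real (f x y) * w y) = (\<Sum>j<card V. of_real (?M $$ (k, j)) * v j)"
      using k by (simp add: w vertex_matrix_def flip: sum_from_nat_into[OF V])
    with v[OF k(1)] k show "(\<Sum>y\<in>V. of_real (f x y) * w y) = z * w x" by (simp add: w)
  qed
qed

section \<open>Estimates for sums over eigenvalues\<close>

lemma sum_mset_Re: "(\<Sum>z\<in>#E. Re (f z)) = Re (\<Sum>z\<in>#E. f z)"
  by (induction E) auto

text \<open>If \<open>k\<close> is the multiplicity of \<open>l\<close>, then the vanishing trace gives \<open>2 k l\<close> for the sum of the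
  absolute values, since negative and positive eigenvalues balance. The bound on the squares forces
  \<open>k l\<^sup>2 < 2 l\<^sup>2\<close>, so \<open>k \<le> 1\<close>.\<close>

lemma sum_cmod_le_if_one_positive_value:
  fixes E :: "complex multiset" and l :: real
  assumes real: "\<And>z. z \<in># E \<Longrightarrow> z \<in> \<real>"
    and pos: "\<And>z. z \<in># E \<Longrightarrow> Re z > 0 \<Longrightarrow> Re z = l"
    and trace: "(\<Sum>z\<in>#E. z) = 0"
    and square: "Re (\<Sum>z\<in>#E. z\<^sup>2) < 2 * l\<^sup>2"
    and l: "l > 0"
  shows "(\<Sum>z\<in>#E. cmod z) \<le> 2 * l"
proof -
  define k where "k = count E (of_real l)"
  have "(\<forall>z\<in>#E. z \<in> \<real> \<and> (Re z > 0 \<longrightarrow> Re z = l)) \<Longrightarrow>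
      (\<Sum>z\<in>#E. cmod z) = 2 * l * count E (of_real l) - (\<Sum>z\<in>#E. Re z) \<and>
      l\<^sup>2 * count E (of_real l) \<le> (\<Sum>z\<in>#E. Re (z\<^sup>2))"
  proof (induction E)
    case (add z E)
    then obtain r where r: "z = of_real r" "r > 0 \<Longrightarrow> r = l" by (auto elim!: Reals_cases)
    then show ?case using add l
      by (cases "r > 0") (auto simp: algebra_simps power2_eq_square add_increasing)
  qed auto
  then have cmod: "(\<Sum>z\<in>#E. cmod z) = 2 * l * k" and sq: "l\<^sup>2 * k \<le> Re (\<Sum>z\<in>#E. z\<^sup>2)"
    using real pos trace by (auto simp: k_def sum_mset_Re)
  have "l\<^sup>2 * k < l\<^sup>2 * 2" using sq square by simp
  then have "k \<le> 1" using l by (simp add: mult_less_cancel_left)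
  then show ?thesis using cmod l by simp
qed

text \<open>Each summand satisfies \<open>\<bar>x - d\<bar> \<ge> (x - d) (2 x / n - 1)\<close> because the second factor lies between
  \<open>-1\<close> and \<open>1\<close>. This quadratic minorant is exact at both ends \<open>0\<close> and \<open>n\<close> of the range when
  \<open>0 \<le> d \<le> n\<close>, and its sum involves only the first two power sums.\<close>

lemma sum_dist_mean_ge:
  fixes E :: "complex multiset" and n d :: real
  assumes range: "\<And>z. z \<in># E \<Longrightarrow> z \<in> \<real> \<and> 0 \<le> Re z \<and> Re z \<le> n"
    and size: "real (size E) = n" and trace: "(\<Sum>z\<in>#E. z) = of_real (n * d)" and n: "n > 0"
  shows "(\<Sum>z\<in>#E. cmod (z - of_real d)) \<ge> 2 / n * Re (\<Sum>z\<in>#E. z\<^sup>2) - 2 * d\<^sup>2"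
proof -
  define g where "g = 2 / n"
  define h where "h = 1 + 2 * d / n"
  have point: "cmod (z - of_real d) \<ge> g * Re (z\<^sup>2) - h * Re z + d" if z: "z \<in># E" for z
  proof -
    obtain r where r: "z = of_real r" "0 \<le> r" "r \<le> n"
      using range[OF z] by (auto elim!: Reals_cases)
    have "\<bar>2 * r / n - 1\<bar> \<le> 1" using r n by (auto simp: abs_le_iff field_simps)
    then have "\<bar>r - d\<bar> * \<bar>2 * r / n - 1\<bar> \<le> \<bar>r - d\<bar> * 1" by (intro mult_left_mono) auto
    then have "(r - d) * (2 * r / n - 1) \<le> \<bar>r - d\<bar>"
      unfolding abs_mult[symmetric] by simp
    moreover have "(r - d) * (2 * r / n - 1) = g * r\<^sup>2 - h * r + d"
      using n by (simp add: g_def h_def field_simps power2_eq_square)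
    moreover have "cmod (z - of_real d) = \<bar>r - d\<bar>"
      unfolding r of_real_diff[symmetric] norm_of_real ..
    moreover have "Re (z\<^sup>2) = r\<^sup>2" using r by (simp add: power2_eq_square)
    ultimately show ?thesis using r by simp
  qed
  \<comment> \<open>The summands are added up over submultisets, where the pointwise bound stays available.\<close>
  have "(\<Sum>z\<in>#F. cmod (z - of_real d)) \<ge>
      g * (\<Sum>z\<in>#F. Re (z\<^sup>2)) - h * (\<Sum>z\<in>#F. Re z) + size F * d" if "F \<subseteq># E" for F
    using that
  proof (induction F)
    case (add z F)
    then have "z \<in># E" "F \<subseteq># E" by (auto dest: mset_subset_eq_insertD subset_mset.less_imp_le)
    with add.IH point[of z] show ?case by (simp add: algebra_simps)
  qed simp
  from this[of E] have "(\<Sum>z\<in>#E. cmod (z - of_real d)) \<ge>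
      2 / n * Re (\<Sum>z\<in>#E. z\<^sup>2) - (1 + 2 * d / n) * (n * d) + n * d"
    using size trace by (simp add: sum_mset_Re g_def h_def)
  also have "2 / n * Re (\<Sum>z\<in>#E. z\<^sup>2) - (1 + 2 * d / n) * (n * d) + n * d =
      2 / n * Re (\<Sum>z\<in>#E. z\<^sup>2) - 2 * d\<^sup>2"
    using n by (simp add: field_simps power2_eq_square)
  finally show ?thesis .
qed

text \<open>The product of the roots is negative, so they cannot be a pair of complex conjugates.\<close>

lemma real_root_of_quadratic:
  fixes z :: complex and r s :: real
  assumes z: "z\<^sup>2 = of_real r * z + of_real s" and s: "s > 0"
  shows "z \<in> \<real>"
proof -
  have re: "(Re z)\<^sup>2 - (Im z)\<^sup>2 = r * Re z + s" and im: "2 * Re z * Im z = r * Im z"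
    using arg_cong[OF z, of Re] arg_cong[OF z, of Im] by (simp_all add: power2_eq_square)
  have "Im z = 0"
  proof (rule ccontr)
    assume "Im z \<noteq> 0"
    with im have "r = 2 * Re z" by simp
    with re have "(Re z)\<^sup>2 + (Im z)\<^sup>2 + s = 0" by (simp add: power2_eq_square)
    with s show False by (smt (verit) zero_le_power2)
  qed
  then show ?thesis by (simp add: complex_is_Real_iff)
qed

section \<open>Complete multipartite graphs\<close>

text \<open>The parts are the nonempty fibres of the labelling \<open>c\<close>.\<close>

definition complete_multipartite :: "'a ugraph \<Rightarrow> ('a \<Rightarrow> 'c) \<Rightarrow> bool" where
  "complete_multipartite \<G> c \<longleftrightarrow> finite (vertices \<G>) \<and>
     edges \<G> = {{x, y} | x y. x \<in> vertices \<G> \<and> y \<in> vertices \<G> \<and> c x \<noteq> c y}"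

definition part_size :: "'a ugraph \<Rightarrow> ('a \<Rightarrow> 'c) \<Rightarrow> 'c \<Rightarrow> nat" where
  "part_size \<G> c t = card {x \<in> vertices \<G>. c x = t}"

context
  fixes \<G> :: "'a ugraph" and c :: "'a \<Rightarrow> 'c"
  assumes cm: "complete_multipartite \<G> c"
begin

lemma finite_vertices: "finite (vertices \<G>)"
  using cm by (simp add: complete_multipartite_def)

lemma edge_iff:
  assumes "x \<in> vertices \<G>" "y \<in> vertices \<G>"
  shows "{x, y} \<in> edges \<G> \<longleftrightarrow> c x \<noteq> c y"
  using cm assms by (auto simp: complete_multipartite_def doubleton_eq_iff)

lemma part_size_le: "part_size \<G> c t \<le> card (vertices \<G>)"
  unfolding part_size_def using finite_vertices by (intro card_mono) auto

lemma vertex_degree_eq: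
  assumes x: "x \<in> vertices \<G>"
  shows "real (vertex_degree \<G> x) = real (card (vertices \<G>)) - real (part_size \<G> c (c x))"
proof -
  let ?V = "vertices \<G>"
  have "{e \<in> edges \<G>. x \<in> e} = (\<lambda>y. {x, y}) ` {y \<in> ?V. c y \<noteq> c x}"
    using cm x unfolding complete_multipartite_def by (auto simp: insert_commute)
  moreover have "inj_on (\<lambda>y. {x, y}) {y \<in> ?V. c y \<noteq> c x}"
    by (auto simp: inj_on_def doubleton_eq_iff)
  ultimately have "vertex_degree \<G> x = card {y \<in> ?V. c y \<noteq> c x}"
    by (simp add: vertex_degree_def card_image)
  also have "{y \<in> ?V. c y \<noteq> c x} = ?V - {y \<in> ?V. c y = c x}" by auto
  also have "card \<dots> = card ?V - part_size \<G> c (c x)"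
    unfolding part_size_def using finite_vertices by (intro card_Diff_subset) auto
  finally show ?thesis using part_size_le by (simp add: of_nat_diff)
qed

lemma handshake: "(\<Sum>x\<in>vertices \<G>. real (vertex_degree \<G> x)) = 2 * real (card (edges \<G>))"
proof -
  let ?V = "vertices \<G>" and ?E = "edges \<G>"
  have "?E \<subseteq> Pow ?V" using cm by (auto simp: complete_multipartite_def)
  then have fE: "finite ?E" using finite_vertices by (meson finite_Pow_iff finite_subset)
  have "(\<Sum>x\<in>?V. vertex_degree \<G> x) = (\<Sum>x\<in>?V. card {e \<in> ?E. x \<in> e})"
    by (simp add: vertex_degree_def)
  also have "\<dots> = 2 * card ?E"
  proof (rule sum_multicount[OF finite_vertices fE], intro ballI)
    fix e assume "e \<in> ?E"
    then obtain x y where e: "e = {x, y}" "x \<in> ?V" "y \<in> ?V" "c x \<noteq> c y"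
      using cm by (auto simp: complete_multipartite_def)
    then have "{v \<in> ?V. v \<in> e} = {x, y}" "x \<noteq> y" by auto
    then show "card {v \<in> ?V. v \<in> e} = 2" by simp
  qed
  finally show ?thesis by (metis of_nat_mult of_nat_numeral of_nat_sum)
qed

lemma adjacency_matrix_eq:
  "adjacency_matrix \<G> = vertex_matrix (vertices \<G>) (\<lambda>x y. if c x \<noteq> c y then 1 else 0)"
proof -
  have "from_nat_into (vertices \<G>) i \<in> vertices \<G>" if "i < card (vertices \<G>)" for i
    using that by (intro from_nat_into) auto
  then show ?thesis
    unfolding adjacency_matrix_def vertex_matrix_def
    by (intro cong_mat) (auto simp: edge_iff)
qed

lemma laplacian_matrix_eq:
  "laplacian_matrix \<G> = vertex_matrix (vertices \<G>)
     (\<lambda>x y. (if x = y then real (vertex_degree \<G> x) else 0) - (if c x \<noteq> c y then 1 else 0))"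
proof -
  have "inj_on (from_nat_into (vertices \<G>)) {..<card (vertices \<G>)}"
    using bij_betw_from_nat_into_finite[OF finite_vertices] by (simp add: bij_betw_def)
  then show ?thesis
    unfolding laplacian_matrix_def adjacency_matrix_eq degree_matrix_def vertex_matrix_def
    by (intro eq_matI) (auto dest: inj_onD)
qed

lemma sum_other_parts:
  fixes w :: "'a \<Rightarrow> 'b :: comm_ring_1"
  shows "(\<Sum>y\<in>vertices \<G>. if c x \<noteq> c y then w y else 0) =
    (\<Sum>y\<in>vertices \<G>. w y) - (\<Sum>y\<in>{y\<in>vertices \<G>. c y = c x}. w y)"
proof -
  have "(\<Sum>y\<in>vertices \<G>. if c x \<noteq> c y then w y else 0) =
      (\<Sum>y\<in>vertices \<G>. w y - (if c y = c x then w y else 0))"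
    by (intro sum.cong) auto
  then show ?thesis
    by (simp add: sum_subtractf sum.inter_filter[OF finite_vertices])
qed

lemma sum_over_parts:
  assumes "c ` vertices \<G> \<subseteq> T" "finite T"
  shows "(\<Sum>x\<in>vertices \<G>. f x) = (\<Sum>t\<in>T. \<Sum>x\<in>{x\<in>vertices \<G>. c x = t}. f x)"
  using sum.group[OF finite_vertices assms(2,1), of f] by simp

text \<open>Let \<open>w\<close> be an eigenvector for \<open>z\<close>, let \<open>S\<close> be the sum of its entries and \<open>P t\<close> the sum over the part
  \<open>t\<close> of size \<open>s t\<close>. Adding the eigenvalue equations over a part gives \<open>(n - z) P t = s t S\<close>, and adding
  these over all parts gives \<open>z S = 0\<close>. If \<open>z\<close> is nonzero then \<open>S = 0\<close>, and the equation at a vertex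
  with nonzero entry leaves only \<open>z = n\<close> and \<open>z = n - s t\<close>.\<close>

lemma laplacian_eigenvalue_range:
  assumes z: "z \<in># eigenvalue_mset (laplacian_matrix \<G>)"
  shows "z \<in> \<real> \<and> 0 \<le> Re z \<and> Re z \<le> real (card (vertices \<G>))"
proof -
  let ?V = "vertices \<G>" and ?s = "\<lambda>t. of_nat (part_size \<G> c t) :: complex"
  let ?n = "of_nat (card ?V) :: complex"
  obtain w x where x: "x \<in> ?V" "w x \<noteq> 0"
    and w: "\<And>x. x \<in> ?V \<Longrightarrow> (\<Sum>y\<in>?V. of_real ((if x = y then real (vertex_degree \<G> x) else 0)
        - (if c x \<noteq> c y then 1 else 0)) * w y) = z * w x"
    using vertex_matrix_eigenvalueE[OF finite_vertices z[unfolded laplacian_matrix_eq]] by blast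
  define S where "S = (\<Sum>y\<in>?V. w y)"
  define P where "P t = (\<Sum>y\<in>{y\<in>?V. c y = t}. w y)" for t
  have eq: "(?n - ?s (c x)) * w x - (S - P (c x)) = z * w x" if x: "x \<in> ?V" for x
  proof -
    have "z * w x = (\<Sum>y\<in>?V. of_real ((if x = y then real (vertex_degree \<G> x) else 0)
        - (if c x \<noteq> c y then 1 else 0)) * w y)" using w[OF x] by simp
    also have "\<dots> = (\<Sum>y\<in>?V. (if x = y then of_real (real (vertex_degree \<G> x)) * w x else 0)
        - (if c x \<noteq> c y then w y else 0))"
      by (intro sum.cong) auto
    also have "\<dots> = of_real (real (vertex_degree \<G> x)) * w x - (S - P (c x))"
      using finite_vertices x by (simp add: sum_subtractf sum_other_parts S_def P_def)
    finally show ?thesis using vertex_degree_eq[OF x] by simp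
  qed
  have part: "(?n - z) * P t = ?s t * S" for t
  proof -
    have "z * P t = (\<Sum>y\<in>{y\<in>?V. c y = t}. (?n - ?s t) * w y - (S - P t))"
      unfolding P_def sum_distrib_left by (intro sum.cong) (auto simp: eq[symmetric] P_def)
    also have "\<dots> = (?n - ?s t) * P t - ?s t * (S - P t)"
      by (simp add: sum_subtractf sum_distrib_left P_def part_size_def)
    finally show ?thesis by (simp add: algebra_simps)
  qed
  have fin: "finite (c ` ?V)" using finite_vertices by simp
  have "(?n - z) * S = (\<Sum>t\<in>c ` ?V. (?n - z) * P t)"
    using sum_over_parts[OF order_refl fin, of w] by (simp add: S_def P_def sum_distrib_left)
  also have "\<dots> = (\<Sum>t\<in>c ` ?V. ?s t) * S" by (simp add: part sum_distrib_right)
  also have "(\<Sum>t\<in>c ` ?V. ?s t) = ?n"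
    using sum_over_parts[OF order_refl fin, of "\<lambda>_. 1 :: complex"] by (simp add: part_size_def)
  finally have "z = 0 \<or> S = 0" by (auto simp: algebra_simps)
  moreover have "z = ?n \<or> z = ?n - ?s (c x)" if "S = 0"
    using part[of "c x"] eq[OF x(1)] x(2) that by auto
  ultimately obtain r where "z = of_real r"
      and "r = 0 \<or> r = card ?V \<or> r = real (card ?V) - real (part_size \<G> c (c x))"
    by (metis of_real_0 of_real_diff of_real_of_nat_eq)
  then show ?thesis using part_size_le[of "c x"] by auto
qed

text \<open>The trace of the Laplacian matrix is the sum of the degrees, and the trace of its square is the sum
  of the degrees and of their squares.\<close>

lemma laplacian_energy_ge:
  fixes d :: real
  defines "d \<equiv> 2 * real (card (edges \<G>)) / real (card (vertices \<G>))"
  assumes ne: "vertices \<G> \<noteq> {}"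
  shows "laplacian_energy \<G> \<ge>
    2 / card (vertices \<G>) * (\<Sum>x\<in>vertices \<G>. real (vertex_degree \<G> x) + (real (vertex_degree \<G> x))\<^sup>2)
      - 2 * d\<^sup>2"
proof -
  let ?V = "vertices \<G>"
  let ?D = "\<lambda>x. real (vertex_degree \<G> x)"
  let ?f = "\<lambda>x y. (if x = y then ?D x else 0) - (if c x \<noteq> c y then 1 else 0)"
  have n: "card ?V > 0" using ne finite_vertices by (simp add: card_gt_0_iff)
  note sums = vertex_matrix_eigenvalue_sums[OF finite_vertices, of ?f, folded laplacian_matrix_eq]
  have tr: "(\<Sum>z\<in>#eigenvalue_mset (laplacian_matrix \<G>). z) = of_real (real (card ?V) * d)"
    using n unfolding sums(2) by (simp add: handshake d_def)
  have "(\<Sum>y\<in>?V. ?f x y * ?f y x) = ?D x + (?D x)\<^sup>2" if x: "x \<in> ?V" for x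
  proof -
    have "(\<Sum>y\<in>?V. ?f x y * ?f y x) =
        (\<Sum>y\<in>?V. (if x = y then (?D x)\<^sup>2 else 0) + (if c x \<noteq> c y then 1 else 0))"
      by (intro sum.cong) (auto simp: power2_eq_square)
    also have "\<dots> = (?D x)\<^sup>2 + (real (card ?V) - real (part_size \<G> c (c x)))"
      using x finite_vertices by (simp add: sum.distrib sum_other_parts part_size_def)
    finally show ?thesis using vertex_degree_eq[OF x] by simp
  qed
  then have sq: "(\<Sum>z\<in>#eigenvalue_mset (laplacian_matrix \<G>). z\<^sup>2) =
      of_real (\<Sum>x\<in>?V. ?D x + (?D x)\<^sup>2)"
    unfolding sums(3) by (simp only: cong: sum.cong)
  show ?thesis
    using sum_dist_mean_ge[OF laplacian_eigenvalue_range _ tr] n sums(1)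
    by (simp add: laplacian_energy_def sq d_def[symmetric])
qed

end

section \<open>Complete multipartite graphs with one exceptional part\<close>

text \<open>Numerical labels turn sums over vertices into sums over \<open>t < m\<close> with one extra term. At least two
  ordinary parts are required: for \<open>m = 1\<close> the graph is bipartite and has the eigenvalues \<open>l\<close> and
  \<open>- l\<close>, so that the squares of the eigenvalues add up to \<open>2 l\<^sup>2\<close> and the count in \<open>energy_le\<close> breaks down.\<close>

locale multipartite_exceptional_part =
  fixes \<G> :: "'a ugraph" and c :: "'a \<Rightarrow> nat" and m a b :: nat
  assumes cm: "complete_multipartite \<G> c"
    and labels: "c ` vertices \<G> \<subseteq> {..m}"
    and exceptional_part: "part_size \<G> c m = a"
    and parts: "\<And>t. t < m \<Longrightarrow> part_size \<G> c t = b"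
    and m: "m \<ge> 2" and a: "a \<ge> 1" and b: "b \<ge> 1"
begin

lemma sum_labels:
  fixes f :: "nat \<Rightarrow> 'b :: comm_ring_1"
  shows "(\<Sum>x\<in>vertices \<G>. f (c x)) = of_nat a * f m + of_nat b * (\<Sum>t<m. f t)"
proof -
  have "(\<Sum>x\<in>vertices \<G>. f (c x)) = (\<Sum>t\<le>m. of_nat (part_size \<G> c t) * f t)"
    unfolding sum_over_parts[OF cm labels finite_atMost] by (intro sum.cong) (auto simp: part_size_def)
  also have "\<dots> = of_nat a * f m + of_nat b * (\<Sum>t<m. f t)"
    by (simp add: lessThan_Suc_atMost[symmetric] exceptional_part parts sum_distrib_left add.commute)
  finally show ?thesis .
qed

lemma card_vertices: "real (card (vertices \<G>)) = real a + real m * real b"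
  using sum_labels[of "\<lambda>_. 1 :: real"] by (simp add: mult.commute)

lemma sum_degrees:
  fixes f :: "real \<Rightarrow> real"
  shows "(\<Sum>x\<in>vertices \<G>. f (real (vertex_degree \<G> x))) =
    real a * f (real m * b) + real m * b * f (a + (real m - 1) * b)"
proof -
  define g where "g t = f (real a + m * b - part_size \<G> c t)" for t
  have "(\<Sum>x\<in>vertices \<G>. f (real (vertex_degree \<G> x))) = (\<Sum>x\<in>vertices \<G>. g (c x))"
    by (intro sum.cong) (auto simp: vertex_degree_eq[OF cm] card_vertices g_def)
  also have "\<dots> = a * g m + b * (\<Sum>t<m. g t)" by (rule sum_labels)
  also have "(\<Sum>t<m. g t) = m * f (a + (real m - 1) * b)"
    by (simp add: g_def parts algebra_simps)
  finally show ?thesis by (simp add: g_def exceptional_part algebra_simps)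
qed

text \<open>With \<open>S\<close> and \<open>P t\<close> the sums of the entries of an eigenvector over all vertices and over the part \<open>t\<close>,
  the eigenvalue equations read \<open>z w x = S - P (c x)\<close>. Adding them over the exceptional part and over
  the union of the others, with sum \<open>T\<close>, gives a linear system for \<open>P m\<close> and \<open>T\<close>, whose determinant
  is the difference of the two sides of the quadratic equation. If both vanish while \<open>z\<close> does not, then \<open>(z + b) P t = 0\<close> for the other parts, and the
  eigenvector would be zero unless \<open>z = - b\<close>.\<close>

lemma adjacency_eigenvalue:
  assumes z: "z \<in># eigenvalue_mset (adjacency_matrix \<G>)"
  shows "z = 0 \<or> z = - of_nat b \<or> z\<^sup>2 = (of_nat m - 1) * of_nat b * z + of_nat m * of_nat a * of_nat b"
proof (rule disjCI)
  assume nz: "\<not> (z = - of_nat b \<or> z\<^sup>2 = (of_nat m - 1) * of_nat b * z + of_nat m * of_nat a * of_nat b)"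
  let ?V = "vertices \<G>" and ?s = "\<lambda>t. of_nat (part_size \<G> c t) :: complex"
  obtain w x where x: "x \<in> ?V" "w x \<noteq> 0"
    and w: "\<And>x. x \<in> ?V \<Longrightarrow> (\<Sum>y\<in>?V. of_real (if c x \<noteq> c y then 1 else 0) * w y) = z * w x"
    using vertex_matrix_eigenvalueE[OF finite_vertices[OF cm] z[unfolded adjacency_matrix_eq[OF cm]]]
    by blast
  define S where "S = (\<Sum>y\<in>?V. w y)"
  define P where "P t = (\<Sum>y\<in>{y\<in>?V. c y = t}. w y)" for t
  have eq: "S - P (c x) = z * w x" if x: "x \<in> ?V" for x
  proof -
    have "z * w x = (\<Sum>y\<in>?V. if c x \<noteq> c y then w y else 0)"
      unfolding w[OF x, symmetric] by (intro sum.cong) auto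
    then show ?thesis by (simp add: sum_other_parts[OF cm] S_def P_def)
  qed
  have part: "z * P t = ?s t * (S - P t)" for t
  proof -
    have "z * P t = (\<Sum>y\<in>{y\<in>?V. c y = t}. S - P t)"
      unfolding P_def sum_distrib_left by (intro sum.cong) (auto simp: eq[symmetric] P_def)
    then show ?thesis by (simp add: part_size_def)
  qed
  define T where "T = (\<Sum>t<m. P t)"
  have S: "S = P m + T"
    unfolding S_def sum_over_parts[OF cm labels finite_atMost]
    by (simp add: lessThan_Suc_atMost[symmetric] T_def P_def)
  have 1: "z * P m = of_nat a * T"
    using part[of m] by (simp add: exceptional_part S)
  have "z * T = (\<Sum>t<m. of_nat b * (S - P t))"
    unfolding T_def sum_distrib_left by (intro sum.cong) (auto simp: part parts)
  also have "\<dots> = of_nat b * (of_nat m * S - T)"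
    by (simp add: T_def sum_distrib_left[symmetric] sum_subtractf)
  finally have 2: "z * T = of_nat b * (of_nat m * P m + (of_nat m - 1) * T)"
    by (simp add: S algebra_simps)
  show "z = 0"
  proof (rule ccontr)
    assume z0: "z \<noteq> 0"
    have "z\<^sup>2 * T = ((of_nat m - 1) * of_nat b * z + of_nat m * of_nat a * of_nat b) * T"
    proof -
      have "z\<^sup>2 * T = of_nat b * (of_nat m * (z * P m) + (of_nat m - 1) * (z * T))"
        using arg_cong[OF 2, of "\<lambda>t. z * t"] by (simp add: power2_eq_square algebra_simps)
      then show ?thesis unfolding 1 by (simp add: algebra_simps)
    qed
    with nz have T: "T = 0" by auto
    with 1 z0 have Pm: "P m = 0" by auto
    have "P t = 0" if "t \<le> m" for t
    proof (cases "t = m")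
      case False
      then have "(z + of_nat b) * P t = 0"
        using part[of t] parts[of t] that by (simp add: S T Pm algebra_simps)
      with nz show ?thesis by (auto simp: add_eq_0_iff2)
    qed (use Pm in simp)
    then have "P (c x) = 0" using labels x by auto
    with eq[OF x(1)] x(2) z0 show False by (simp add: S T Pm)
  qed
qed

text \<open>The quadratic has one positive root \<open>l\<close>, and the other two candidates for eigenvalues are not positive.
  Twice the number of edges is \<open>2 m a b + m (m - 1) b\<^sup>2\<close>, which is less than
  \<open>2 l\<^sup>2 = 2 m a b + 2 (m - 1) b l\<close> because \<open>2 l > m b\<close>.\<close>

lemma energy_le:
  fixes l :: real
  assumes l: "l > 0" and root: "l\<^sup>2 = (real m - 1) * b * l + real m * a * b"
  shows "energy \<G> \<le> 2 * l"
  unfolding energy_def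
proof (rule sum_cmod_le_if_one_positive_value)
  let ?f = "\<lambda>x y. if c x \<noteq> c y then 1 else (0::real)"
  note sums = vertex_matrix_eigenvalue_sums[OF finite_vertices[OF cm], of ?f,
      folded adjacency_matrix_eq[OF cm]]
  define r s where "r = (real m - 1) * b" and "s = real m * a * b"
  have s: "s > 0" using m a b by (simp add: s_def)
  have spec: "z = 0 \<or> z = - of_nat b \<or> z\<^sup>2 = of_real r * z + of_real s"
    if "z \<in># eigenvalue_mset (adjacency_matrix \<G>)" for z
    using adjacency_eigenvalue[OF that] by (simp add: r_def s_def)
  show real: "z \<in> \<real>" if "z \<in># eigenvalue_mset (adjacency_matrix \<G>)" for z
    using spec[OF that] real_root_of_quadratic[OF _ s] by auto
  show "Re z = l" if z: "z \<in># eigenvalue_mset (adjacency_matrix \<G>)" "Re z > 0" for z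
  proof -
    obtain t where t: "z = of_real t" using real[OF z(1)] by (auto elim: Reals_cases)
    with z have t0: "t > 0" by simp
    have "z \<noteq> 0" "z \<noteq> - of_nat b" using z(2) by auto
    with spec[OF z(1)] t have "complex_of_real (t\<^sup>2) = of_real (r * t + s)" by simp
    then have "t\<^sup>2 = r * t + s" by (simp only: of_real_eq_iff)
    with root have prod: "(t - l) * (t + l - r) = 0"
      by (simp add: r_def s_def power2_eq_square algebra_simps)
    \<comment> \<open>If \<open>t\<close> were the other root, then \<open>t l = - s < 0\<close>.\<close>
    have "t + l - r \<noteq> 0"
    proof
      assume "t + l - r = 0"
      then have "r = t + l" by simp
      with \<open>t\<^sup>2 = r * t + s\<close> have "t * l + s = 0" by (simp add: power2_eq_square algebra_simps)
      with s t0 l show False by (smt (verit) mult_pos_pos)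
    qed
    with prod t show ?thesis by simp
  qed
  show "(\<Sum>z\<in>#eigenvalue_mset (adjacency_matrix \<G>). z) = 0" unfolding sums(2) by simp
  have "(\<Sum>x\<in>vertices \<G>. \<Sum>y\<in>vertices \<G>. ?f x y * ?f y x) =
      (\<Sum>x\<in>vertices \<G>. real (vertex_degree \<G> x))"
  proof (intro sum.cong HOL.refl)
    fix x assume x: "x \<in> vertices \<G>"
    have "(\<Sum>y\<in>vertices \<G>. ?f x y * ?f y x) = (\<Sum>y\<in>vertices \<G>. if c x \<noteq> c y then 1 else 0)"
      by (intro sum.cong) auto
    then show "(\<Sum>y\<in>vertices \<G>. ?f x y * ?f y x) = real (vertex_degree \<G> x)"
      unfolding sum_other_parts[OF cm] by (simp add: vertex_degree_eq[OF cm x] part_size_def)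
  qed
  also have "\<dots> = 2 * s + real m * b * r"
    using sum_degrees[of "\<lambda>x. x"] by (simp add: r_def s_def algebra_simps)
  finally have sq: "(\<Sum>x\<in>vertices \<G>. \<Sum>y\<in>vertices \<G>. ?f x y * ?f y x) = 2 * s + real m * b * r" .
  \<comment> \<open>At \<open>m b / 2\<close> the quadratic is negative, as \<open>m \<ge> 2\<close>, so the positive root lies beyond.\<close>
  have "real m * b < 2 * l"
  proof (rule ccontr)
    assume "\<not> real m * b < 2 * l"
    then have lm: "l \<le> real m * b / 2" by simp
    have "l * (l - r) = s" using root by (simp add: r_def s_def power2_eq_square algebra_simps)
    then have "l - r > 0" using l s by (metis zero_less_mult_pos)
    then have "l * (l - r) \<le> (real m * b / 2) * (real m * b / 2 - r)"
      using l lm by (intro mult_mono) auto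
    also have "real m * b / 2 - r \<le> 0"
      using mult_right_mono[of 2 "real m" "real b"] m by (simp add: r_def field_simps)
    then have "(real m * b / 2) * (real m * b / 2 - r) \<le> 0" by (intro mult_nonneg_nonpos) auto
    finally show False using \<open>l * (l - r) = s\<close> s by simp
  qed
  moreover have "r > 0" using m b by (simp add: r_def)
  ultimately have "real m * b * r < 2 * l * r" by simp
  then show "Re (\<Sum>z\<in>#eigenvalue_mset (adjacency_matrix \<G>). z\<^sup>2) < 2 * l\<^sup>2"
    unfolding sums(3) sq Re_complex_of_real using root by (simp add: r_def s_def algebra_simps)
qed (fact l)

end

text \<open>Since \<open>l (l - K) = P K\<close>, it suffices that \<open>X (X - K) \<ge> P K\<close> for the right-hand side \<open>X\<close>. In terms of
  \<open>W\<close> and \<open>U\<close> below, \<open>X = P K W / n\<^sup>2\<close> and \<open>X - K = K U / n\<^sup>2\<close>, so this is \<open>K W U \<ge> n ^ 4\<close>. The leading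
  terms nearly cancel because \<open>(P\<^sup>2 - 1) (Q\<^sup>2 - 1) = n\<^sup>2 - (P - Q)\<^sup>2\<close>, and the remaining terms all carry
  the factor \<open>(P - Q)\<^sup>2\<close>.\<close>

lemma positive_root_le:
  fixes P Q l :: real
  defines "K \<equiv> (P - 1) * (Q - 1)" and "n \<equiv> P * Q - 1"
  assumes P: "P \<ge> 2" and Q: "Q \<ge> 2" and l: "l > 0" and root: "l\<^sup>2 = K * l + P * K"
  shows "l \<le> P * K * ((Q + 1) * n + (P - Q)\<^sup>2) / n\<^sup>2"
proof -
  have K: "K \<ge> 1" using mult_mono[of 1 "P - 1" 1 "Q - 1"] P Q by (simp add: K_def)
  have n: "n > 0" using mult_mono[of 2 P 2 Q] P Q by (simp add: n_def)
  define D where "D = (P - Q)\<^sup>2"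
  have D: "D \<ge> 0" by (simp add: D_def)
  define W U where "W = (Q + 1) * n + D" and "U = (P + 1) * n + P * D"
  define R where "R = n * (P + 1) + P * n * (Q + 1) + P * D"
  have WU: "K * W * U - n ^ 4 = D * (K * R - n\<^sup>2)"
  proof -
    have "K * ((P + 1) * (Q + 1)) = n\<^sup>2 - D"
      by (simp add: K_def n_def D_def power2_eq_square algebra_simps)
    moreover have "K * W * U = K * ((P + 1) * (Q + 1)) * n\<^sup>2 + D * (K * R)"
      by (simp add: W_def U_def R_def power2_eq_square algebra_simps)
    ultimately have "K * W * U = (n\<^sup>2 - D) * n\<^sup>2 + D * (K * R)" by simp
    then show ?thesis by (simp add: power2_eq_square power4_eq_xxxx algebra_simps)
  qed
  have "n * n \<le> n * (P * (Q + 1))" using n P by (intro mult_left_mono) (auto simp: n_def algebra_simps)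
  moreover have "0 \<le> n * (P + 1)" "0 \<le> P * D" using n P D by auto
  ultimately have nR: "n\<^sup>2 \<le> R" by (simp add: R_def power2_eq_square algebra_simps)
  note nR
  also have "R \<le> K * R"
    using K mult_right_mono[of 1 K R] order_trans[OF zero_le_power2 nR] by simp
  finally have "0 \<le> D * (K * R - n\<^sup>2)" using D by simp
  with WU have KWU: "n ^ 4 \<le> K * W * U" by simp

  define X where "X = P * K * W / n\<^sup>2"
  have X0: "X > 0" using P Q K n D by (simp add: X_def W_def add_pos_nonneg)
  have XK: "X - K = K * U / n\<^sup>2"
  proof -
    have "P * W - n\<^sup>2 = U"
      by (simp add: W_def U_def n_def power2_eq_square algebra_simps)
    moreover have "X - K = K * (P * W - n\<^sup>2) / n\<^sup>2" using n by (simp add: X_def field_simps)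
    ultimately show ?thesis by simp
  qed
  have "P * K \<le> P * K * (K * W * U / n ^ 4)"
    using KWU n P K mult_left_mono[of 1 "K * W * U / n ^ 4" "P * K"] by simp
  also have "\<dots> = X * (X - K)"
    unfolding XK by (simp add: X_def power2_eq_square power4_eq_xxxx mult_ac)
  finally have X: "P * K \<le> X * (X - K)" .
  have "l \<le> X"
  proof (rule ccontr)
    assume less: "\<not> l \<le> X"
    have "0 < P * K" using P K by simp
    with X have "0 < X * (X - K)" by linarith
    then have "0 < X - K" using X0 by (simp add: zero_less_mult_iff)
    then have "X * (X - K) < l * (l - K)" using less X0 by (intro mult_strict_mono) auto
    also have "\<dots> = P * K" using root by (simp add: power2_eq_square algebra_simps)
    finally show False using X by simp
  qed
  then show ?thesis by (simp add: X_def W_def D_def)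
qed

text \<open>The trace bound for the Laplacian energy evaluates to exactly \<open>2 X\<close>, and the energy is at most \<open>2 l\<close>
  for the explicit positive root \<open>l\<close>.\<close>

lemma energy_le_laplacian_energy_multipartite:
  assumes "multipartite_exceptional_part \<G> c p (p - 1) (q - 1)"
  shows "energy \<G> \<le> laplacian_energy \<G>"
proof -
  interpret multipartite_exceptional_part \<G> c p "p - 1" "q - 1" by fact
  define P Q where "P = real p" and "Q = real q"
  have P: "P \<ge> 2" and Q: "Q \<ge> 2" and Pm: "real (p - 1) = P - 1" and Qm: "real (q - 1) = Q - 1"
    using m b by (auto simp: P_def Q_def of_nat_diff)
  define K n where "K = (P - 1) * (Q - 1)" and "n = P * Q - 1"
  have K: "K \<ge> 1" using mult_mono[of 1 "P - 1" 1 "Q - 1"] P Q by (simp add: K_def)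
  have n: "n > 0" using mult_mono[of 2 P 2 Q] P Q by (simp add: n_def)
  have card: "real (card (vertices \<G>)) = n"
    unfolding card_vertices Pm Qm by (simp add: n_def P_def[symmetric] algebra_simps)

  define X where "X = P * K * ((Q + 1) * n + (P - Q)\<^sup>2) / n\<^sup>2"
  have LE: "2 * X \<le> laplacian_energy \<G>"
  proof -
    have deg: "(\<Sum>x\<in>vertices \<G>. f (real (vertex_degree \<G> x))) =
        (P - 1) * f (P * (Q - 1)) + P * (Q - 1) * f (Q * (P - 1))" for f :: "real \<Rightarrow> real"
      unfolding sum_degrees Pm Qm by (simp add: P_def[symmetric] algebra_simps)
    have "2 * real (card (edges \<G>)) = P * K * (Q + 1)"
      using deg[of "\<lambda>x. x"] handshake[OF cm] by (simp add: K_def algebra_simps)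
    moreover have "(\<Sum>x\<in>vertices \<G>. real (vertex_degree \<G> x) + (real (vertex_degree \<G> x))\<^sup>2) =
        P * K * ((Q + 1) + P * (Q - 1) + Q\<^sup>2 * (P - 1))"
      using deg[of "\<lambda>x. x + x\<^sup>2"] by (simp add: K_def power2_eq_square algebra_simps)
    moreover have "vertices \<G> \<noteq> {}" using card n by auto
    ultimately have "2 / n * (P * K * ((Q + 1) + P * (Q - 1) + Q\<^sup>2 * (P - 1)))
        - 2 * (P * K * (Q + 1) / n)\<^sup>2 \<le> laplacian_energy \<G>"
      using laplacian_energy_ge[OF cm] by (simp add: card)
    also have "2 / n * (P * K * ((Q + 1) + P * (Q - 1) + Q\<^sup>2 * (P - 1)))
        - 2 * (P * K * (Q + 1) / n)\<^sup>2 =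
      2 * (P * K) * (n * ((Q + 1) + P * (Q - 1) + Q\<^sup>2 * (P - 1)) - P * K * (Q + 1)\<^sup>2) / n\<^sup>2"
      using n by (simp add: field_simps power2_eq_square)
    also have "n * ((Q + 1) + P * (Q - 1) + Q\<^sup>2 * (P - 1)) - P * K * (Q + 1)\<^sup>2 =
        (Q + 1) * n + (P - Q)\<^sup>2"
      by (simp add: n_def K_def power2_eq_square algebra_simps)
    finally show ?thesis by (simp add: X_def)
  qed

  define l where "l = (K + sqrt (K\<^sup>2 + 4 * (P * K))) / 2"
  have l: "l > 0" using K P by (simp add: l_def add_pos_nonneg)
  have root: "l\<^sup>2 = K * l + P * K"
  proof -
    have "(sqrt (K\<^sup>2 + 4 * (P * K)))\<^sup>2 = K\<^sup>2 + 4 * (P * K)" using K P by simp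
    then show ?thesis by (simp add: l_def power2_eq_square field_simps)
  qed
  have E: "energy \<G> \<le> 2 * l"
    using energy_le[OF l] root unfolding Pm Qm by (simp add: P_def[symmetric] K_def algebra_simps)

  have "l \<le> X"
    unfolding X_def using positive_root_le[OF P Q l] root by (simp add: K_def n_def)
  with E LE show ?thesis by simp
qed

section \<open>The group as a group of affine maps\<close>

abbreviation power_word :: "'g \<Rightarrow> nat \<Rightarrow> 'g word" where
  "power_word g n \<equiv> replicate n (g, True)"

lemma power_word_mod:
  assumes "pres_eq R (power_word g n) []"
  shows "pres_eq R (power_word g k) (power_word g (k mod n))"
proof -
  have "pres_eq R (power_word g (n * j + r)) (power_word g r)" for j r
  proof (induction j)
    case (Suc j)
    have "pres_eq R (power_word g n @ power_word g (n * j + r)) ([] @ power_word g r)"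
      by (rule pres_eq_append[OF assms Suc])
    then show ?case by (simp add: replicate_add[symmetric] add.assoc)
  qed (simp add: pres_eq.refl)
  from this[of "k div n" "k mod n"] show ?thesis by simp
qed

text \<open>In a group where a generator has finite order, its inverse is a nonnegative power. This is what
  allows all words below to be brought into a form without inverse letters.\<close>

lemma inverse_letter_power_word:
  assumes "pres_eq R (power_word g n) []" and "n > 0"
  shows "pres_eq R [(g, False)] (power_word g (n - 1))"
proof -
  have "pres_eq R ([(g, False)] @ power_word g n @ []) ([(g, False)] @ [] @ [])"
    by (rule pres_eq_context[OF assms(1)])
  moreover have "pres_eq R ([] @ [(g, False), (g, \<not> False)] @ power_word g (n - 1))
      ([] @ power_word g (n - 1))"
    by (rule pres_eq.cancel)
  moreover have "power_word g n = (g, True) # power_word g (n - 1)"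
    using assms(2) by (cases n) auto
  ultimately show ?thesis by (auto intro: pres_eq.trans pres_eq.sym)
qed

lemma gen_pow_power_word:
  assumes "pres_eq R (power_word g n) []" and "n > 0"
  obtains k where "pres_eq R (gen_pow g z) (power_word g k)"
proof -
  have "\<exists>k. pres_eq R (replicate m (g, False)) (power_word g k)" for m
  proof (induction m)
    case 0
    show ?case using pres_eq.refl[of R "[]"] by (intro exI[of _ 0]) simp
  next
    case (Suc m)
    then obtain k where "pres_eq R (replicate m (g, False)) (power_word g k)" by blast
    from pres_eq_append[OF inverse_letter_power_word[OF assms] this]
    show ?case by (auto simp: replicate_add[symmetric])
  qed
  then show ?thesis
    using that pres_eq.refl by (cases "0 \<le> z") (auto simp: gen_pow_def)
qed

locale frobenius_presentation =
  fixes p q :: nat and u :: int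
  assumes prime_p: "prime p" and q: "q \<ge> 2"
    and order: "\<And>k. [u ^ k = 1] (mod int p) \<longleftrightarrow> q dvd k"
begin

abbreviation equiv_word :: "gen word \<Rightarrow> gen word \<Rightarrow> bool" (infix \<open>\<approx>\<close> 50) where
  "v \<approx> w \<equiv> pres_eq (F_relations p q u) v w"

text \<open>A word acts on residues modulo \<open>p\<close> from the right, its first letter acting first, by
  \<open>x \<mapsto> linear_part * x + translation_part\<close>, where \<open>a\<close> is \<open>x \<mapsto> x + 1\<close> and \<open>b\<close> is \<open>x \<mapsto> u x\<close>. The power
  \<open>u ^ (q - 1)\<close> stands for the inverse of \<open>u\<close>.\<close>

fun linear_part :: "gen word \<Rightarrow> int" where
  "linear_part [] = 1"
| "linear_part ((Gen_a, s) # w) = linear_part w"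
| "linear_part ((Gen_b, s) # w) = (if s then u else u ^ (q - 1)) * linear_part w"

fun translation_part :: "gen word \<Rightarrow> int" where
  "translation_part [] = 0"
| "translation_part ((Gen_a, s) # w) = (if s then 1 else - 1) * linear_part w + translation_part w"
| "translation_part ((Gen_b, s) # w) = translation_part w"

lemma linear_part_append: "linear_part (v @ w) = linear_part v * linear_part w"
  by (induction v rule: linear_part.induct) auto

lemma translation_part_append:
  "translation_part (v @ w) = translation_part v * linear_part w + translation_part w"
  by (induction v rule: linear_part.induct) (auto simp: linear_part_append algebra_simps)

lemma affine_gen_pow_a:
  "linear_part (gen_pow Gen_a k) = 1" "translation_part (gen_pow Gen_a k) = k"
proof -
  have "linear_part (replicate n (Gen_a, s)) = 1 \<and>
      translation_part (replicate n (Gen_a, s)) = (if s then int n else - int n)" for n s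
    by (induction n) auto
  then show "linear_part (gen_pow Gen_a k) = 1" "translation_part (gen_pow Gen_a k) = k"
    by (auto simp: gen_pow_def)
qed

lemma affine_power_b:
  "linear_part (power_word Gen_b k) = u ^ k" "translation_part (power_word Gen_b k) = 0"
  by (induction k) auto

lemma affine_normal_form:
  "linear_part (power_word Gen_b k @ power_word Gen_a i) = u ^ k"
  "translation_part (power_word Gen_b k @ power_word Gen_a i) = int i"
  using affine_gen_pow_a[of "int i"]
  by (auto simp: linear_part_append translation_part_append affine_power_b gen_pow_def)

lemma u_power_q: "[u * u ^ (q - 1) = 1] (mod int p)"
  using order[of q] q by (simp add: power_eq_if[of u q])

definition same_map :: "gen word \<Rightarrow> gen word \<Rightarrow> bool" where
  "same_map v w \<longleftrightarrow> [linear_part v = linear_part w] (mod int p) \<and>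
     [translation_part v = translation_part w] (mod int p)"

lemma same_map_context: "same_map v w \<Longrightarrow> same_map (xs @ v @ ys) (xs @ w @ ys)"
  unfolding same_map_def linear_part_append translation_part_append
  by (intro conjI cong_add cong_mult cong_refl) auto

text \<open>The defining relations hold for the affine maps; the third one is \<open>u (u ^ (q - 1) x + 1) = x + u\<close>.\<close>

lemma equiv_word_imp_same_map: "v \<approx> w \<Longrightarrow> same_map v w"
proof (induction rule: pres_eq.induct)
  case (cancel xs g s ys)
  have "same_map [(g, s), (g, \<not> s)] []"
    using u_power_q by (cases g; cases s) (auto simp: same_map_def mult.commute)
  from same_map_context[OF this] show ?case by simp
next
  case (relation l r xs ys)
  have "gen_pow Gen_b (int q) = power_word Gen_b q" by (simp add: gen_pow_def)
  moreover have "gen_pow Gen_b (- 1) = [(Gen_b, False)]" "gen_pow Gen_b 1 = [(Gen_b, True)]"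
    by (simp_all add: gen_pow_def)
  moreover have "[int p = 0] (mod int p)" "[u ^ q = 1] (mod int p)"
    using order[of q] by (simp_all add: cong_def)
  ultimately have "same_map l r"
    using relation u_power_q
    by (auto simp: F_relations_def same_map_def linear_part_append translation_part_append
        affine_gen_pow_a affine_power_b mult.commute)
  then show ?case by (rule same_map_context)
qed (auto simp: same_map_def intro: cong_sym cong_trans)

lemma power_word_relations:
  "power_word Gen_a p \<approx> []" "power_word Gen_b q \<approx> []"
  using pres_eq.relation[of "gen_pow Gen_a (int p)" "[]" "F_relations p q u" "[]" "[]"]
    pres_eq.relation[of "gen_pow Gen_b (int q)" "[]" "F_relations p q u" "[]" "[]"]
  by (simp_all add: F_relations_def gen_pow_def)

lemma p_pos: "p > 0" and q_pos: "q > 0"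
  using prime_p q by (auto simp: prime_gt_0_nat)

text \<open>The relation \<open>b ^ (-1) a b = a ^ u\<close> in the form \<open>a b = b a ^ u\<close>, applied once for each \<open>a\<close>.\<close>

lemma move_b_left:
  obtains j where "power_word Gen_a i @ [(Gen_b, True)] \<approx> (Gen_b, True) # power_word Gen_a j"
proof -
  let ?a = "(Gen_a, True)" and ?b = "(Gen_b, True)"
  obtain u' where u': "gen_pow Gen_a u \<approx> power_word Gen_a u'"
    using gen_pow_power_word[OF power_word_relations(1) p_pos] by blast
  have "[] @ [?b, (Gen_b, \<not> True)] @ [?a, ?b] \<approx> [] @ [?a, ?b]" by (rule pres_eq.cancel)
  moreover have "[?b] @ (gen_pow Gen_b (-1) @ gen_pow Gen_a 1 @ gen_pow Gen_b 1) @ []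
      \<approx> [?b] @ gen_pow Gen_a u @ []"
    by (rule pres_eq.relation) (simp add: F_relations_def)
  moreover have "[?b] @ gen_pow Gen_a u @ [] \<approx> [?b] @ power_word Gen_a u' @ []"
    by (rule pres_eq_context[OF u'])
  ultimately have ab: "[?a, ?b] \<approx> ?b # power_word Gen_a u'"
    by (simp add: gen_pow_def) (meson pres_eq.trans pres_eq.sym)
  have "power_word Gen_a i @ [?b] \<approx> ?b # power_word Gen_a (u' * i)"
  proof (induction i)
    case (Suc i)
    have "[?a] @ (power_word Gen_a i @ [?b]) @ [] \<approx> [?a] @ (?b # power_word Gen_a (u' * i)) @ []"
      by (rule pres_eq_context[OF Suc])
    moreover have "[] @ [?a, ?b] @ power_word Gen_a (u' * i) \<approx>
        [] @ (?b # power_word Gen_a u') @ power_word Gen_a (u' * i)"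
      by (rule pres_eq_context[OF ab])
    ultimately show ?case
      by (simp add: replicate_add) (rule pres_eq.trans)
  qed (simp add: pres_eq.refl)
  then show ?thesis by (rule that)
qed

text \<open>Letters are appended on the right, where each one is a power of a generator: a power of \<open>a\<close> is absorbed,
  and a power of \<open>b\<close> is moved to the left past the power of \<open>a\<close>.\<close>

lemma normal_form:
  obtains k i where "k < q" "i < p" "w \<approx> power_word Gen_b k @ power_word Gen_a i"
proof -
  have "\<exists>k i. w \<approx> power_word Gen_b k @ power_word Gen_a i"
  proof (induction w rule: rev_induct)
    case Nil
    show ?case using pres_eq.refl[of "F_relations p q u" "[]"]
      by (intro exI[of _ 0]) simp
  next
    case (snoc x w)
    have letter: "\<exists>n. [(g, s)] \<approx> power_word g n" for g s
      using inverse_letter_power_word[OF power_word_relations(1) p_pos]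
        inverse_letter_power_word[OF power_word_relations(2) q_pos]
        pres_eq.refl[of "F_relations p q u" "[(g, s)]"]
      by (cases g; cases s) (auto intro: exI[of _ "Suc 0"])
    obtain k i where w: "w \<approx> power_word Gen_b k @ power_word Gen_a i" using snoc by blast
    have b: "\<exists>j. power_word Gen_a i @ power_word Gen_b n \<approx> power_word Gen_b n @ power_word Gen_a j" for n
    proof (induction n)
      case 0
      show ?case using pres_eq.refl by auto
    next
      case (Suc n)
      then obtain j where j: "power_word Gen_a i @ power_word Gen_b n \<approx> power_word Gen_b n @ power_word Gen_a j"
        by blast
      obtain j' where j': "power_word Gen_a j @ [(Gen_b, True)] \<approx> (Gen_b, True) # power_word Gen_a j'"
        using move_b_left by blast
      from pres_eq.trans[OF pres_eq_context[OF j, of "[]" "[(Gen_b, True)]", simplified]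
          pres_eq_context[OF j', of "power_word Gen_b n" "[]", simplified]]
      show ?case by (auto simp: replicate_append_same replicate_app_Cons_same)
    qed
    obtain g s where x: "x = (g, s)" by (cases x)
    obtain n where n: "[x] \<approx> power_word g n" using letter x by blast
    have wx: "w @ [x] \<approx> (power_word Gen_b k @ power_word Gen_a i) @ power_word g n"
      by (rule pres_eq_append[OF w n])
    show ?case
    proof (cases g)
      case Gen_a
      with wx show ?thesis by (auto simp: replicate_add[symmetric])
    next
      case Gen_b
      obtain j where "power_word Gen_a i @ power_word Gen_b n \<approx> power_word Gen_b n @ power_word Gen_a j"
        using b by blast
      from pres_eq_context[OF this, of "power_word Gen_b k" "[]"] wx Gen_b
      have "w @ [x] \<approx> power_word Gen_b (k + n) @ power_word Gen_a j"
        by (auto simp: replicate_add intro: pres_eq.trans)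
      then show ?thesis by blast
    qed
  qed
  then obtain k i where "w \<approx> power_word Gen_b k @ power_word Gen_a i" by blast
  then have "w \<approx> power_word Gen_b (k mod q) @ power_word Gen_a (i mod p)"
    by (rule pres_eq.trans)
      (intro pres_eq_append power_word_mod power_word_relations)
  then show ?thesis using that p_pos q_pos by (meson mod_less_divisor)
qed

lemma u_power_inj:
  assumes "[u ^ k = u ^ l] (mod int p)" "k < q" "l < q"
  shows "k = l"
  using assms
proof (induction k l rule: linorder_wlog)
  case (le k l)
  have coprime: "coprime (u ^ k) (int p)"
    using order[of q] q u_power_q by (metis coprime_iff_invertible_int coprime_power_left_iff)
  moreover have "[u ^ k * 1 = u ^ k * u ^ (l - k)] (mod int p)"
    using le by (simp flip: power_add)
  ultimately have "[1 = u ^ (l - k)] (mod int p)"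
    using cong_mult_lcancel[OF coprime] by blast
  then have "q dvd l - k" using order by (metis cong_sym)
  with le show ?case by (auto dest: dvd_imp_le)
next
  case (sym k l)
  then show ?case by (metis cong_sym)
qed

text \<open>The action is faithful: every word has a normal form \<open>b ^ k a ^ i\<close> with \<open>k < q\<close> and \<open>i < p\<close>, and it acts by
  \<open>x \<mapsto> u ^ k x + i\<close>, from which \<open>k\<close> and \<open>i\<close> can be recovered.\<close>

lemma equiv_word_iff_same_map: "v \<approx> w \<longleftrightarrow> same_map v w"
proof
  assume vw: "same_map v w"
  obtain k i where k: "k < q" "i < p" and v: "v \<approx> power_word Gen_b k @ power_word Gen_a i"
    using normal_form by blast
  obtain l j where l: "l < q" "j < p" and w: "w \<approx> power_word Gen_b l @ power_word Gen_a j"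
    using normal_form by blast
  have "same_map (power_word Gen_b k @ power_word Gen_a i) (power_word Gen_b l @ power_word Gen_a j)"
    using vw equiv_word_imp_same_map[OF v] equiv_word_imp_same_map[OF w]
    unfolding same_map_def by (meson cong_sym cong_trans)
  then have "[u ^ k = u ^ l] (mod int p)" "[int i = int j] (mod int p)"
    by (simp_all add: same_map_def affine_normal_form)
  then have "k = l" "i = j"
    using u_power_inj k l by (auto simp: cong_def)
  with v w show "v \<approx> w" by (meson pres_eq.sym pres_eq.trans)
qed (rule equiv_word_imp_same_map)

section \<open>The non-commuting graph\<close>

abbreviation frobenius_group :: "gen word set monoid" where
  "frobenius_group \<equiv> F_group p q u"

abbreviation element :: "gen word \<Rightarrow> gen word set" where
  "element \<equiv> pres_class (F_relations p q u)"

lemma carrier_frobenius_group: "carrier frobenius_group = range element"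
  by (simp add: F_group_def presented_group_def)

lemma element_eq_iff: "element v = element w \<longleftrightarrow> same_map v w"
  by (simp add: pres_class_eq_iff equiv_word_iff_same_map)

text \<open>The difference of the translation parts of the two products; the linear parts of the products always
  agree.\<close>

lemma commute_iff:
  "element v \<otimes>\<^bsub>frobenius_group\<^esub> element w = element w \<otimes>\<^bsub>frobenius_group\<^esub> element v \<longleftrightarrow>
    int p dvd translation_part v * (linear_part w - 1) - translation_part w * (linear_part v - 1)"
  unfolding F_group_def presented_group_mult element_eq_iff same_map_def linear_part_append
    translation_part_append
  by (simp add: cong_iff_dvd_diff algebra_simps)

lemma u_power_minus_one: "k < q \<Longrightarrow> int p dvd u ^ k - 1 \<longleftrightarrow> k = 0"
  using order[of k] by (auto simp: cong_iff_dvd_diff dest: dvd_imp_le)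

text \<open>For \<open>k \<noteq> 0\<close> the word acts by \<open>x \<mapsto> u ^ k x + t (1 - u ^ k)\<close>, the map with linear part \<open>u ^ k\<close> that fixes \<open>t\<close>.
  For \<open>k = 0\<close> it is the translation by \<open>t\<close>.\<close>

definition vertex_word :: "nat \<times> nat \<Rightarrow> gen word" where
  "vertex_word = (\<lambda>(k, t). power_word Gen_b k @
     power_word Gen_a (if k = 0 then t else nat (int t * (1 - u ^ k) mod int p)))"

definition vertex_index :: "(nat \<times> nat) set" where
  "vertex_index = {0} \<times> {1..<p} \<union> {1..<q} \<times> {..<p}"

text \<open>The label of a map is its fixed point; translations get \<open>p\<close>, which lies outside the range of the
  fixed points.\<close>

definition index_label :: "nat \<times> nat \<Rightarrow> nat" where
  "index_label = (\<lambda>(k, t). if k = 0 then p else t)"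

lemma affine_vertex_word:
  "linear_part (vertex_word (k, t)) = u ^ k"
  "[translation_part (vertex_word (k, t)) = (if k = 0 then int t else int t * (1 - u ^ k))] (mod int p)"
  using p_pos by (auto simp: vertex_word_def affine_normal_form affine_normal_form(2)[of 0, simplified])

lemma prime_int_p: "prime (int p)"
  using prime_p by simp

lemma int_p_dvd_diff_iff: "s < p \<Longrightarrow> t < p \<Longrightarrow> int p dvd int s - int t \<longleftrightarrow> s = t"
  by (metis cong_iff_dvd_diff cong_int_iff cong_less_modulus_unique_nat cong_refl)

text \<open>For two maps with fixed points \<open>s\<close> and \<open>t\<close>, the commutator condition of \<open>commute_iff\<close> becomes
  divisibility of \<open>(s - t) (u ^ k - 1) (u ^ l - 1)\<close> by \<open>p\<close>, where the last two factors are units. For the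
  translation by \<open>s\<close> and a map with a fixed point it becomes divisibility of \<open>s (u ^ l - 1)\<close>.\<close>

lemma vertex_word_commute_iff:
  assumes "i \<in> vertex_index" "j \<in> vertex_index"
  shows "element (vertex_word i) \<otimes>\<^bsub>frobenius_group\<^esub> element (vertex_word j) =
      element (vertex_word j) \<otimes>\<^bsub>frobenius_group\<^esub> element (vertex_word i) \<longleftrightarrow>
    index_label i = index_label j"
proof -
  obtain k s where i: "i = (k, s)" by (cases i)
  obtain l t where j: "j = (l, t)" by (cases j)
  define S T where "S = (if k = 0 then int s else int s * (1 - u ^ k))"
    and "T = (if l = 0 then int t else int t * (1 - u ^ l))"
  have kl: "k < q" "l < q" and st: "s < p" "t < p" using assms q_pos
    by (auto simp: i j vertex_index_def)
  have "[translation_part (vertex_word i) * (u ^ l - 1) - translation_part (vertex_word j) * (u ^ k - 1)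
      = S * (u ^ l - 1) - T * (u ^ k - 1)] (mod int p)"
    unfolding i j S_def T_def by (intro cong_diff cong_mult affine_vertex_word cong_refl)
  then have "int p dvd translation_part (vertex_word i) * (u ^ l - 1)
        - translation_part (vertex_word j) * (u ^ k - 1) \<longleftrightarrow>
      int p dvd S * (u ^ l - 1) - T * (u ^ k - 1)"
    by (rule cong_dvd_iff[OF cong_sym, symmetric])
  also have "\<dots> \<longleftrightarrow> index_label i = index_label j"
  proof (cases "k = 0"; cases "l = 0")
    assume "k \<noteq> 0" "l \<noteq> 0"
    moreover from this have "S * (u ^ l - 1) - T * (u ^ k - 1) =
        - ((int s - int t) * (u ^ k - 1) * (u ^ l - 1))"
      by (simp add: S_def T_def algebra_simps)
    ultimately show ?thesis
      using kl st by (simp add: prime_dvd_mult_iff[OF prime_int_p] u_power_minus_one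
          int_p_dvd_diff_iff index_label_def i j)
  next
    assume "k = 0" "l \<noteq> 0"
    moreover from this have "\<not> int p dvd int s" "t \<noteq> p"
      using assms st by (auto simp: i j vertex_index_def dest: dvd_imp_le)
    ultimately show ?thesis
      using kl by (simp add: prime_dvd_mult_iff[OF prime_int_p] u_power_minus_one S_def index_label_def i j)
  next
    assume "k \<noteq> 0" "l = 0"
    moreover from this have "\<not> int p dvd int t" "s \<noteq> p"
      using assms st by (auto simp: i j vertex_index_def dest: dvd_imp_le)
    ultimately show ?thesis
      using kl by (simp add: prime_dvd_mult_iff[OF prime_int_p] u_power_minus_one T_def index_label_def i j)
  qed (auto simp: index_label_def i j)
  finally show ?thesis unfolding commute_iff by (simp add: i j affine_vertex_word)
qed

text \<open>Equal elements commute, so their labels agree; this settles the fixed points. The exponents \<open>k\<close> agree by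
  comparison of the linear parts.\<close>

lemma inj_vertex_word: "inj_on (element \<circ> vertex_word) vertex_index"
proof (rule inj_onI)
  fix i j assume ij: "i \<in> vertex_index" "j \<in> vertex_index"
    and "(element \<circ> vertex_word) i = (element \<circ> vertex_word) j"
  then have eq: "element (vertex_word i) = element (vertex_word j)" by simp
  then have same: "same_map (vertex_word i) (vertex_word j)" by (simp add: element_eq_iff)
  have label: "index_label i = index_label j"
    using vertex_word_commute_iff[OF ij] unfolding eq by simp
  obtain k s where i: "i = (k, s)" by (cases i)
  obtain l t where j: "j = (l, t)" by (cases j)
  have "k < q" "l < q" and st: "s < p" "t < p" using ij q_pos by (auto simp: i j vertex_index_def)
  with same have kl: "k = l"
    using u_power_inj by (simp add: same_map_def i j affine_vertex_word)
  show "i = j"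
  proof (cases "k = 0")
    case True
    then have "[int s = int t] (mod int p)"
      using same kl affine_vertex_word(2)[of 0 s] affine_vertex_word(2)[of 0 t]
      unfolding same_map_def i j by (metis (full_types) cong_sym cong_trans)
    with st kl show ?thesis by (simp add: i j cong_iff_dvd_diff int_p_dvd_diff_iff)
  qed (use label kl in \<open>simp add: index_label_def i j\<close>)
qed

text \<open>No indexed element is central because there are two labels. Conversely, a normal form
  \<open>b ^ k a ^ i\<close> with \<open>k \<noteq> 0\<close> has a fixed point since \<open>1 - u ^ k\<close> is invertible modulo \<open>p\<close>, and one with \<open>k = 0\<close>
  is a translation, by a nonzero residue unless it is the identity.\<close>

lemma image_vertex_word:
  "(element \<circ> vertex_word) ` vertex_index = carrier frobenius_group - group_center frobenius_group"
proof (intro equalityI subsetI)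
  fix x assume "x \<in> (element \<circ> vertex_word) ` vertex_index"
  then obtain i where i: "i \<in> vertex_index" "x = element (vertex_word i)" by auto
  have "(0, 1) \<in> vertex_index" "(1, 0) \<in> vertex_index"
    using prime_p q p_pos by (auto simp: vertex_index_def prime_gt_1_nat dest: prime_gt_1_nat)
  moreover have "index_label (0, 1) \<noteq> index_label (1, 0)"
    using p_pos by (simp add: index_label_def)
  ultimately obtain j where "j \<in> vertex_index" "index_label i \<noteq> index_label j" by metis
  then have "x \<otimes>\<^bsub>frobenius_group\<^esub> element (vertex_word j) \<noteq>
      element (vertex_word j) \<otimes>\<^bsub>frobenius_group\<^esub> x"
    using vertex_word_commute_iff[OF i(1)] unfolding i(2) by simp
  moreover have "x \<in> carrier frobenius_group" "element (vertex_word j) \<in> carrier frobenius_group"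
    unfolding i(2) carrier_frobenius_group by (rule rangeI)+
  ultimately show "x \<in> carrier frobenius_group - group_center frobenius_group"
    unfolding group_center_def Diff_iff mem_Collect_eq by metis
next
  fix x assume x: "x \<in> carrier frobenius_group - group_center frobenius_group"
  then obtain w where w: "x = element w" by (auto simp: carrier_frobenius_group)
  obtain k i where ki: "k < q" "i < p" "w \<approx> power_word Gen_b k @ power_word Gen_a i"
    using normal_form by blast
  then have x_eq: "x = element (power_word Gen_b k @ power_word Gen_a i)"
    by (simp add: w pres_class_eq_iff)
  show "x \<in> (element \<circ> vertex_word) ` vertex_index"
  proof (cases "k = 0")
    case True
    have "i \<noteq> 0"
    proof
      assume "i = 0"
      with True x_eq have "x \<in> group_center frobenius_group"
        by (auto simp: group_center_def carrier_frobenius_group commute_iff)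
      with x show False by simp
    qed
    with True ki have "(k, i) \<in> vertex_index" "x = element (vertex_word (k, i))"
      by (simp_all add: vertex_index_def vertex_word_def x_eq)
    then show ?thesis by auto
  next
    case False
    have "\<not> int p dvd 1 - u ^ k"
      using u_power_minus_one[OF ki(1)] False by (metis dvd_minus_iff minus_diff_eq)
    then have "coprime (1 - u ^ k) (int p)"
      using prime_int_p by (metis coprime_commute prime_imp_coprime)
    then obtain y where y: "[(1 - u ^ k) * y = 1] (mod int p)"
      using cong_solve_coprime_int by blast
    define t where "t = nat (int i * y mod int p)"
    have t: "t < p" "[int t = int i * y] (mod int p)"
      using p_pos by (auto simp: t_def nat_less_iff)
    have "[int t * (1 - u ^ k) = int i * ((1 - u ^ k) * y)] (mod int p)"
      using cong_mult[OF t(2) cong_refl[of "1 - u ^ k"]] by (simp add: mult_ac)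
    also have "[int i * ((1 - u ^ k) * y) = int i * 1] (mod int p)"
      by (intro cong_mult cong_refl y)
    finally have "[int i = int t * (1 - u ^ k)] (mod int p)" by (simp add: cong_sym)
    then have "same_map (power_word Gen_b k @ power_word Gen_a i) (vertex_word (k, t))"
      using affine_vertex_word[of k t] False
      by (auto simp: same_map_def affine_normal_form intro: cong_trans cong_sym)
    then have "x = element (vertex_word (k, t))" by (simp add: x_eq element_eq_iff)
    moreover have "(k, t) \<in> vertex_index" using False ki t by (simp add: vertex_index_def)
    ultimately show ?thesis by auto
  qed
qed

lemma noncommuting_graph_multipartite:
  "multipartite_exceptional_part (noncommuting_graph frobenius_group)
     (index_label \<circ> the_inv_into vertex_index (element \<circ> vertex_word)) p (p - 1) (q - 1)"
proof -
  let ?G = "noncommuting_graph frobenius_group"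
  let ?\<phi> = "element \<circ> vertex_word"
  define c where "c = index_label \<circ> the_inv_into vertex_index ?\<phi>"
  have V: "vertices ?G = ?\<phi> ` vertex_index"
    unfolding image_vertex_word by (simp add: noncommuting_graph_def)
  have c: "c (?\<phi> i) = index_label i" if "i \<in> vertex_index" for i
    using the_inv_into_f_f[OF inj_vertex_word that] by (simp add: c_def)
  have part: "part_size ?G c t = card {i \<in> vertex_index. index_label i = t}" for t
  proof -
    have "{x \<in> vertices ?G. c x = t} = ?\<phi> ` {i \<in> vertex_index. index_label i = t}"
      using c by (auto simp: V)
    then have "part_size ?G c t = card (?\<phi> ` {i \<in> vertex_index. index_label i = t})"
      by (simp only: part_size_def)
    also have "\<dots> = card {i \<in> vertex_index. index_label i = t}"
      by (intro card_image inj_on_subset[OF inj_vertex_word]) auto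
    finally show ?thesis .
  qed
  have "multipartite_exceptional_part ?G c p (p - 1) (q - 1)"
  proof
    have finite_V: "finite (vertices ?G)"
      unfolding V vertex_index_def by (intro finite_imageI) auto
    have comm: "x \<otimes>\<^bsub>frobenius_group\<^esub> y \<noteq> y \<otimes>\<^bsub>frobenius_group\<^esub> x \<longleftrightarrow> c x \<noteq> c y"
      if xy: "x \<in> vertices ?G" "y \<in> vertices ?G" for x y
    proof -
      obtain i j where i: "i \<in> vertex_index" "x = ?\<phi> i" and j: "j \<in> vertex_index" "y = ?\<phi> j"
        using xy unfolding V by (elim imageE)
      show ?thesis
        using vertex_word_commute_iff[OF i(1) j(1)] c[OF i(1)] c[OF j(1)]
        unfolding i(2) j(2) o_apply by simp
    qed
    have "edges ?G = {{x, y} | x y. x \<in> vertices ?G \<and> y \<in> vertices ?G \<and>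
        x \<otimes>\<^bsub>frobenius_group\<^esub> y \<noteq> y \<otimes>\<^bsub>frobenius_group\<^esub> x}"
      by (simp only: noncommuting_graph_def ugraph.simps)
    also have "\<dots> = {{x, y} | x y. x \<in> vertices ?G \<and> y \<in> vertices ?G \<and> c x \<noteq> c y}"
      by (intro Collect_cong ex_cong1 conj_cong HOL.refl comm)
    finally show "complete_multipartite ?G c"
      unfolding complete_multipartite_def using finite_V by (rule conjI[rotated])
    show "c ` vertices ?G \<subseteq> {..p}"
      using c by (auto simp: V index_label_def vertex_index_def)
    have "{i \<in> vertex_index. index_label i = p} = {0} \<times> {1..<p}"
      by (auto simp: vertex_index_def index_label_def)
    then show "part_size ?G c p = p - 1" by (simp add: part card_cartesian_product)
    fix t assume "t < p"
    then have "{i \<in> vertex_index. index_label i = t} = {1..<q} \<times> {t}"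
      by (auto simp: vertex_index_def index_label_def)
    then show "part_size ?G c t = q - 1" by (simp add: part card_cartesian_product)
  qed (use prime_gt_1_nat[OF prime_p] q in auto)
  then show ?thesis by (simp add: c_def)
qed

end

theorem theorem4p5:
  fixes p q :: nat and u :: int
  assumes "prime p" and "prime q"
    and "q dvd (p - 1)"
    and "q ^ 2 < q + p + 1"
    and "u mod int p \<in> carrier (units_of (residue_ring (int p)))"
    and "group.ord (units_of (residue_ring (int p))) (u mod int p) = q"
  shows "energy (noncommuting_graph (F_group p q u))
           \<le> laplacian_energy (noncommuting_graph (F_group p q u))"
proof -
  have p: "int p > 1" using prime_gt_1_nat[OF assms(1)] by simp
  interpret residues "int p" "residue_ring (int p)" by unfold_locales (use p in auto)
  interpret units: group "units_of (residue_ring (int p))" by (rule units_group)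
  have "[u ^ k = 1] (mod int p) \<longleftrightarrow> q dvd k" for k
  proof -
    have "(u mod int p) [^]\<^bsub>units_of (residue_ring (int p))\<^esub> k = u ^ k mod int p"
      using assms(5) by (simp add: units_of_pow units_of_carrier pow_cong)
    moreover have "\<one>\<^bsub>units_of (residue_ring (int p))\<^esub> = 1"
      by (simp add: units_of_one res_one_eq)
    ultimately show ?thesis
      using units.pow_eq_id[OF assms(5), of k] assms(6) p by (simp add: cong_def)
  qed
  then interpret frobenius_presentation p q u
    using assms(1) prime_ge_2_nat[OF assms(2)] by unfold_locales auto
  show ?thesis
    by (rule energy_le_laplacian_energy_multipartite[OF noncommuting_graph_multipartite])
qed

end
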